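(* Let $n\ge 4$, $\alpha,\beta\in\mathbb{C}$, $C\in\mathbb{C}^{(n-2)\times 2}$, $D\in\mathbb{C}^{2\times(n-2)}$, and $$A=\begin{bmatrix}\alpha I_{n-2} & C\\ D & \beta I_2\end{bmatrix},\qquad H=C^*C+DD^*,\qquad Z=DC.$$ Let $h_1,h_2$ be the eigenvalues of $H$, let $z_1,z_2$ be the eigenvalues of $Z$, and let $z_{ij}$ ($i,j=1,2$) be the entries of $Z$ in the orthonormal basis of the eigenvectors of $H$ (by convention choosing $Z$ to be diagonal when $H$ is a scalar multiple of the identity). Then the numerical range $W(A)$ is the convex hull of (finitely many) ellipses centered at $(\alpha+\beta)/2$ if and only if at least one of the following conditions holds: (i) $Z$ is normal and commutes with $H$; (ii) the eigenvalues of $Z$ coincide, and $Z$ shares an eigenvector with $H$; (iii) $H$ and $Z$ are such that $$-(h_1-h_2)^2\,\frac{z_{12}z_{21}}{(z_1-z_2)^2}=\left(|z_{12}|+|z_{21}|\right)^2.$$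
   Context: For $A\in\mathbb{C}^{n\times n}$ the numerical range is $W(A)=\{\langle Ax,x\rangle: x\in\mathbb{C}^n,\ \|x\|=1\}\subset\mathbb{C}$, with the standard inner product. When $z_1=z_2$ the left-hand side in (iii) is undefined, and (iii) is regarded as not holding. *)

theory Defs
  imports
    "HOL-Analysis.Convex"
    "Jordan_Normal_Form.Schur_Decomposition"
begin

(* The inner product v \<bullet>c w is linear in v and conjugate-linear in w, so this is the
   set of all <Ax, x>; the condition x \<bullet>c x = 1 says that x is a unit vector. *)
definition numerical_range :: "complex mat \<Rightarrow> complex set" where
  "numerical_range A =
     {(A *\<^sub>v x) \<bullet>c x | x. x \<in> carrier_vec (dim_row A) \<and> x \<bullet>c x = 1}"

(* a and b are the semi-axes and phi is the direction of the major axis.  The degenerate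
   cases b = 0 (a line segment) and a = b = 0 (a point) count as ellipses: they do occur,
   e.g. W(A) is the segment joining alpha and beta when C = 0 and D = 0. *)
definition is_ellipse_centered_at :: "complex \<Rightarrow> complex set \<Rightarrow> bool" where
  "is_ellipse_centered_at c S \<longleftrightarrow>
     (\<exists>a b \<phi> :: real. 0 \<le> b \<and> b \<le> a \<and>
        S = range (\<lambda>t :: real. c + cis \<phi> * Complex (a * cos t) (b * sin t)))"

definition is_hull_of_ellipses_centered_at :: "complex \<Rightarrow> complex set \<Rightarrow> bool" where
  "is_hull_of_ellipses_centered_at c W \<longleftrightarrow>
     (\<exists>\<E>. finite \<E> \<and> (\<forall>S\<in>\<E>. is_ellipse_centered_at c S) \<and> W = convex hull (\<Union>\<E>))"

definition normal_matrix :: "complex mat \<Rightarrow> bool" where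
  "normal_matrix Z \<longleftrightarrow> Z * mat_adjoint Z = mat_adjoint Z * Z"

definition orthonormal_basis2 :: "complex vec \<Rightarrow> complex vec \<Rightarrow> bool" where
  "orthonormal_basis2 u1 u2 \<longleftrightarrow>
     u1 \<in> carrier_vec 2 \<and> u2 \<in> carrier_vec 2 \<and>
     u1 \<bullet>c u1 = 1 \<and> u2 \<bullet>c u2 = 1 \<and> u1 \<bullet>c u2 = 0"

(* For an orthonormal basis u1, u2, the entry of Z in row i and column j with respect to
   that basis is onb_entry Z ui uj = <Z uj, ui>. *)
definition onb_entry :: "complex mat \<Rightarrow> complex vec \<Rightarrow> complex vec \<Rightarrow> complex" where
  "onb_entry Z v w = (Z *\<^sub>v w) \<bullet>c v"

definition diagonal_in_onb2 :: "complex mat \<Rightarrow> complex vec \<Rightarrow> complex vec \<Rightarrow> bool" where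
  "diagonal_in_onb2 Z u1 u2 \<longleftrightarrow> onb_entry Z u1 u2 = 0 \<and> onb_entry Z u2 u1 = 0"

(* When H is not scalar, every orthonormal basis of eigenvectors of H is admissible.  When
   H is scalar, every orthonormal basis consists of eigenvectors of H, and one has to take
   a basis in which Z is diagonal.  If H is scalar and no such orthonormal basis exists
   (i.e. Z is not normal), any orthonormal basis is admitted. *)
definition admissible_eigenbasis2 ::
  "complex mat \<Rightarrow> complex mat \<Rightarrow> complex \<Rightarrow> complex \<Rightarrow> complex vec \<Rightarrow> complex vec \<Rightarrow> bool" where
  "admissible_eigenbasis2 H Z h1 h2 u1 u2 \<longleftrightarrow>
     orthonormal_basis2 u1 u2 \<and> eigenvector H u1 h1 \<and> eigenvector H u2 h2 \<and>
     ((\<exists>c. H = c \<cdot>\<^sub>m 1\<^sub>m 2) \<and> (\<exists>v1 v2. orthonormal_basis2 v1 v2 \<and> diagonal_in_onb2 Z v1 v2)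
        \<longrightarrow> diagonal_in_onb2 Z u1 u2)"

end

(* Put c = (alpha + beta) / 2.  For a unit w with e = w^2, the maximum of Re (w z) over the
   numerical range W is Re (w c) + sqrt (g(e) + sqrt (q(e)) / 4), where g is a real trigonometric
   polynomial of degree 1 and q is the discriminant of the Hermitian 2x2 matrix
   H + e Z + (e Z)^*.  For an ellipse centered at c the same maximum is
   Re (w c) + sqrt (u + Re (e k)) with |k| <= u.  If W is the hull of finitely many ellipses,
   one of them touches the support line of W for infinitely many e, which forces q to be the
   square of a trigonometric polynomial p of degree 1; conversely q = p^2 splits the support
   function into the maximum of two of ellipse type, and a compact convex set (W is convex by
   Toeplitz-Hausdorff) is determined by its support function.  In terms of the entries
   of Z in an eigenbasis of H, the identity q = p^2 is a system for the two coefficients of p,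
   and its solvability is the disjunction (i)-(iii). *)
theory Submission
  imports "HOL-Analysis.Function_Topology" "HOL-Analysis.Convex_Euclidean_Space" Defs
begin


text \<open>The off-diagonal block of the Hermitian part of \<open>w A\<close> is half of M = w C +
  (cnj w) D^H, and |M v|^2 = <H v, v> + 2 Re (w^2 <Z v, v>). Hence \<open>C\<close> and
  \<open>D\<close> enter the support function only through \<open>H\<close> and \<open>Z\<close>,
  and \<open>w\<close> enters there only through e = w^2. Maximising over directions and then over
  the norms of the two blocks of a unit vector yields a root nested in a root. An ellipse has only
  the outer root, so where one ellipse touches, sqrt (q(e)) itself is a trigonometric polynomial of
  degree 1, with no sign to choose. Globally it is only |p|, and |p| = max p (-p) is what produces
  two ellipses. The identity q = p^2 alone does not give them: a branch u + Re (e k) belongs to an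
  ellipse only if |k| <= u. This holds since g(e) +- sqrt (q(e)) / 4 is the square of a real number
  plus a quarter of an eigenvalue of M^H M, hence nonnegative for every e. In the code, q is
  normalised as the square of half the eigenvalue gap, that is (trace^2 - 4 det) / 4.\<close>

section \<open>Trigonometric polynomials of degree at most 2 on the unit circle\<close>

text \<open>On the circle \<open>cnj e\<close> is 1 / e, so twice the expression times e^2 is an
  ordinary polynomial in \<open>e\<close> of degree at most 4; infinitely many roots kill all its
  coefficients.\<close>

lemma trigonometric_polynomial_eq_0:
  fixes k0 :: real and k1 k2 :: complex
  assumes "infinite E"
    and "\<And>e. e \<in> E \<Longrightarrow> cmod e = 1"
    and "\<And>e. e \<in> E \<Longrightarrow> k0 + Re (e * k1) + Re (e\<^sup>2 * k2) = 0"
  shows "k0 = 0" "k1 = 0" "k2 = 0"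
proof -
  define p where "p = [:cnj k2, cnj k1, 2 * complex_of_real k0, k1, k2:]"
  have "poly p e = 0" if "e \<in> E" for e
  proof -
    have u: "e * cnj e = 1"
      using assms(2)[OF that] by (simp add: complex_norm_square[symmetric])
    have "0 = 2 * complex_of_real (k0 + Re (e * k1) + Re (e\<^sup>2 * k2)) * e\<^sup>2"
      using assms(3)[OF that] by simp
    also have "\<dots> = (2 * k0 + (e * k1 + cnj (e * k1)) + (e\<^sup>2 * k2 + cnj (e\<^sup>2 * k2))) * e\<^sup>2"
      unfolding complex_add_cnj by (simp del: times_complex.sel)
    also have "\<dots> = 2 * k0 * e\<^sup>2 + e ^ 3 * k1 + (e * cnj e) * e * cnj k1 + e ^ 4 * k2 + (e * cnj e)\<^sup>2 * cnj k2"
      by (simp add: algebra_simps power2_eq_square power3_eq_cube power4_eq_xxxx)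
    also have "\<dots> = poly p e"
      by (simp add: p_def u algebra_simps power2_eq_square power3_eq_cube power4_eq_xxxx)
    finally show ?thesis by simp
  qed
  then have "E \<subseteq> {e. poly p e = 0}" by auto
  with assms(1) have "p = 0"
    using poly_roots_finite finite_subset by blast
  then show "k0 = 0" "k1 = 0" "k2 = 0" by (auto simp: p_def)
qed

text \<open>The three equations say that the trigonometric polynomial \<open>trig_discriminant d t x y\<close>
  below equals \<open>(a + 2 Re (e b))\<^sup>2\<close> on the unit circle, coefficient by coefficient.\<close>
definition discriminant_is_square :: "real \<Rightarrow> complex \<Rightarrow> complex \<Rightarrow> complex \<Rightarrow> bool" where
  "discriminant_is_square d t x y \<longleftrightarrow>
     (\<exists>(a :: real) (b :: complex). b\<^sup>2 = t\<^sup>2 + x * y \<and> a * b = d * t \<and>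
        a\<^sup>2 + 2 * (cmod b)\<^sup>2 = d\<^sup>2 + 2 * (cmod t)\<^sup>2 + (cmod x)\<^sup>2 + (cmod y)\<^sup>2)"

lemma Re_add_cnj_sq:
  "(2 * Re z)\<^sup>2 = 2 * (cmod z)\<^sup>2 + 2 * Re (z\<^sup>2)"
  unfolding cmod_power2 by (simp add: power2_eq_square)

lemma trig_form_expand:
  assumes "cmod e = 1"
  shows "(d + 2 * Re (e * t))\<^sup>2 =
    d\<^sup>2 + 2 * (cmod t)\<^sup>2 + Re (e * (4 * d * t)) + Re (e\<^sup>2 * (2 * t\<^sup>2))"
proof -
  have "(d + 2 * Re (e * t))\<^sup>2 = d\<^sup>2 + 4 * d * Re (e * t) + (2 * Re (e * t))\<^sup>2"
    by (simp add: power2_eq_square algebra_simps del: times_complex.sel)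
  also have "(2 * Re (e * t))\<^sup>2 = 2 * (cmod t)\<^sup>2 + 2 * Re ((e * t)\<^sup>2)"
    unfolding Re_add_cnj_sq using assms by (simp add: norm_mult del: times_complex.sel)
  also have "2 * Re ((e * t)\<^sup>2) = Re (e\<^sup>2 * (2 * t\<^sup>2))"
    by (simp add: power_mult_distrib)
  also have "4 * d * Re (e * t) = Re (e * (4 * d * t))"
    by (simp add: algebra_simps)
  finally show ?thesis by simp
qed

lemma cmod_add_sq: "(cmod (u + v))\<^sup>2 = (cmod u)\<^sup>2 + (cmod v)\<^sup>2 + 2 * Re (u * cnj v)"
  unfolding cmod_power2 by (simp add: power2_eq_square algebra_simps)

lemma trig_form_offdiag:
  assumes "cmod e = 1"
  shows "(cmod (e * x + cnj (e * y)))\<^sup>2 = (cmod x)\<^sup>2 + (cmod y)\<^sup>2 + Re (e\<^sup>2 * (2 * (x * y)))"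
proof -
  have "(cmod (e * x + cnj (e * y)))\<^sup>2 = (cmod (e * x))\<^sup>2 + (cmod (e * y))\<^sup>2 + 2 * Re ((e * x) * (e * y))"
    unfolding cmod_add_sq complex_cnj_cnj complex_mod_cnj ..
  also have "2 * Re ((e * x) * (e * y)) = Re (e\<^sup>2 * (2 * (x * y)))"
    by (simp add: power2_eq_square algebra_simps)
  finally show ?thesis using assms by (simp add: norm_mult del: times_complex.sel)
qed

text \<open>For \<open>d\<close> = (h1 - h2) / 2, \<open>t\<close> = (z11 - z22) / 2,
  \<open>x\<close> = z12, \<open>y\<close> = z21 this is the square of half the gap between the
  eigenvalues of the Hermitian matrix H + e Z + (e Z)^H, written in an eigenbasis of H.\<close>

definition trig_discriminant :: "real \<Rightarrow> complex \<Rightarrow> complex \<Rightarrow> complex \<Rightarrow> complex \<Rightarrow> real" where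
  "trig_discriminant d t x y e = (d + 2 * Re (e * t))\<^sup>2 + (cmod (e * x + cnj (e * y)))\<^sup>2"

lemma trig_discriminant_expand:
  assumes "cmod e = 1"
  shows "trig_discriminant d t x y e =
    (d\<^sup>2 + 2 * (cmod t)\<^sup>2 + (cmod x)\<^sup>2 + (cmod y)\<^sup>2) + Re (e * (4 * d * t)) + Re (e\<^sup>2 * (2 * (t\<^sup>2 + x * y)))"
  unfolding trig_discriminant_def trig_form_expand[OF assms] trig_form_offdiag[OF assms]
  by (simp add: algebra_simps)

lemma discriminant_is_squareD:
  assumes "discriminant_is_square d t x y"
  obtains a b where
    "\<And>e. cmod e = 1 \<Longrightarrow> trig_discriminant d t x y e = (a + 2 * Re (e * b))\<^sup>2"
proof -
  from assms obtain a :: real and b :: complex where ab: "b\<^sup>2 = t\<^sup>2 + x * y" "a * b = d * t"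
      "a\<^sup>2 + 2 * (cmod b)\<^sup>2 = d\<^sup>2 + 2 * (cmod t)\<^sup>2 + (cmod x)\<^sup>2 + (cmod y)\<^sup>2"
    by (auto simp: discriminant_is_square_def)
  have c: "4 * complex_of_real d * t = 4 * complex_of_real a * b" using ab(2) by simp
  then have "trig_discriminant d t x y e = (a + 2 * Re (e * b))\<^sup>2" if "cmod e = 1" for e
    unfolding trig_discriminant_expand[OF that] trig_form_expand[OF that] ab(3) ab(1)[symmetric] c
    by (simp del: times_complex.sel)
  then show thesis by (rule that)
qed

lemma discriminant_is_squareI:
  assumes "infinite E" "\<And>e. e \<in> E \<Longrightarrow> cmod e = 1"
    and "\<And>e. e \<in> E \<Longrightarrow> trig_discriminant d t x y e = (a + 2 * Re (e * b))\<^sup>2"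
  shows "discriminant_is_square d t x y"
proof -
  define k0 where "k0 = d\<^sup>2 + 2 * (cmod t)\<^sup>2 + (cmod x)\<^sup>2 + (cmod y)\<^sup>2 - (a\<^sup>2 + 2 * (cmod b)\<^sup>2)"
  define k1 where "k1 = 4 * d * t - 4 * a * b"
  define k2 where "k2 = 2 * (t\<^sup>2 + x * y) - 2 * b\<^sup>2"
  have "k0 + Re (e * k1) + Re (e\<^sup>2 * k2) = 0" if "e \<in> E" for e
    using assms(3)[OF that] unfolding trig_form_expand[OF assms(2)[OF that]]
      trig_discriminant_expand[OF assms(2)[OF that]] k0_def k1_def k2_def right_diff_distrib
    by (simp del: times_complex.sel)
  note z = trigonometric_polynomial_eq_0[OF assms(1,2) this]
  have "b\<^sup>2 = t\<^sup>2 + x * y" using z(3) unfolding k2_def by (metis eq_iff_diff_eq_0 mult_left_cancel zero_neq_numeral)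
  moreover have "a * b = d * t" using z(2) by (simp add: k1_def)
  moreover have "a\<^sup>2 + 2 * (cmod b)\<^sup>2 = d\<^sup>2 + 2 * (cmod t)\<^sup>2 + (cmod x)\<^sup>2 + (cmod y)\<^sup>2"
    using z(1) by (simp add: k0_def)
  ultimately show ?thesis unfolding discriminant_is_square_def by blast
qed

section \<open>Solvability of the square equations\<close>

text \<open>With the values of \<open>d\<close>, \<open>t\<close>, \<open>x\<close>,
  \<open>y\<close> given at \<open>trig_discriminant\<close>, t^2 + x y is a quarter of (z1 - z2)^2
  and the disjuncts become (i), (ii), (iii). From left to right, b = 0 leads to (ii); b nonzero with
  d = 0 is an equality case of the triangle inequality and leads to (i); otherwise t / b is real,
  and the position of its square relative to 1 decides.\<close>

lemma discriminant_is_square_iff: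
  "discriminant_is_square d t x y \<longleftrightarrow>
     (cmod x = cmod y \<and> t * cnj y = cnj t * x \<and> d * x = 0 \<and> d * y = 0)
   \<or> (t\<^sup>2 + x * y = 0 \<and> (d = 0 \<or> x = 0 \<or> y = 0))
   \<or> (t\<^sup>2 + x * y \<noteq> 0 \<and>
       - ((complex_of_real d)\<^sup>2) * (x * y / (t\<^sup>2 + x * y)) = complex_of_real ((cmod x + cmod y)\<^sup>2))"
  (is "_ \<longleftrightarrow> ?N \<or> ?S \<or> ?T")
proof
  assume "discriminant_is_square d t x y"
  then obtain a :: real and b :: complex where b2: "b\<^sup>2 = t\<^sup>2 + x * y" and ab: "a * b = d * t" and
      nrm: "a\<^sup>2 + 2 * (cmod b)\<^sup>2 = d\<^sup>2 + 2 * (cmod t)\<^sup>2 + (cmod x)\<^sup>2 + (cmod y)\<^sup>2"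
    by (auto simp: discriminant_is_square_def)
  show "?N \<or> ?S \<or> ?T"
  proof (cases "b = 0")
    case True
    then have "t\<^sup>2 + x * y = 0" using b2 by simp
    moreover have "d = 0 \<or> x = 0 \<or> y = 0" using ab True calculation by auto
    ultimately show ?thesis by blast
  next
    case b0: False
    show ?thesis
    proof (cases "d = 0")
      case True
      have a0: "a = 0" using ab b0 True by simp
      have e: "2 * cmod (t\<^sup>2 + x * y) = 2 * (cmod t)\<^sup>2 + (cmod x)\<^sup>2 + (cmod y)\<^sup>2"
        using nrm a0 True by (simp add: b2[symmetric] norm_power)
      \<comment> \<open>Together with \<open>e\<close> this bounds |x|^2 + |y|^2 by 2 |x|
        |y|.\<close>
      have "cmod (t\<^sup>2 + x * y) \<le> (cmod t)\<^sup>2 + cmod x * cmod y"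
        using norm_triangle_ineq[of "t\<^sup>2" "x * y"] by (simp add: norm_power norm_mult)
      then have "(cmod x - cmod y)\<^sup>2 \<le> 0"
        using e by (simp add: power2_eq_square algebra_simps)
      then have xy: "cmod x = cmod y" by simp
      have e2: "(cmod (t\<^sup>2 + x * y))\<^sup>2 = ((cmod t)\<^sup>2 + (cmod y)\<^sup>2)\<^sup>2"
        using e xy by simp
      \<comment> \<open>Lagrange's identity for the pairs (t, y) and (t, x); equality in
        Cauchy-Schwarz makes the first term vanish.\<close>
      have "(cmod (t * cnj y - cnj t * x))\<^sup>2 + (cmod (t\<^sup>2 + x * y))\<^sup>2
          = ((cmod t)\<^sup>2 + (cmod y)\<^sup>2) * ((cmod t)\<^sup>2 + (cmod x)\<^sup>2)"
        unfolding cmod_power2 by (simp add: power2_eq_square algebra_simps)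
      then have "(cmod (t * cnj y - cnj t * x))\<^sup>2 = 0"
        using e2 xy by (simp add: power2_eq_square)
      then show ?thesis using xy True by simp
    next
      case d0: False
      \<comment> \<open>As \<open>a\<close> and \<open>d\<close> are real,
        \<open>a * b = d * t\<close> makes \<open>t\<close> a real multiple of \<open>b\<close>, and
        the other two equations become conditions on this ratio.\<close>
      define s where "s = a / d"
      have t: "t = s * b" using ab d0 by (simp add: s_def field_simps)
      have a: "a = s * d" using d0 by (simp add: s_def)
      have xy: "x * y = (1 - s\<^sup>2) * b\<^sup>2"
        using b2 by (simp add: t power_mult_distrib algebra_simps)
      have nt: "(cmod t)\<^sup>2 = s\<^sup>2 * (cmod b)\<^sup>2"
        by (simp add: t norm_mult power_mult_distrib)
      have key: "(s\<^sup>2 - 1) * (d\<^sup>2 - 2 * (cmod b)\<^sup>2) = (cmod x)\<^sup>2 + (cmod y)\<^sup>2"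
        using nrm unfolding nt a by (simp add: power_mult_distrib algebra_simps)
      have nxy: "cmod x * cmod y = \<bar>1 - s\<^sup>2\<bar> * (cmod b)\<^sup>2"
      proof -
        have "cmod (x * y) = cmod (complex_of_real (1 - s\<^sup>2)) * cmod (b\<^sup>2)"
          unfolding xy by (simp add: norm_mult)
        then show ?thesis unfolding norm_of_real by (simp add: norm_mult norm_power)
      qed
      consider "s\<^sup>2 = 1" | "s\<^sup>2 > 1" | "s\<^sup>2 < 1" by linarith
      then show ?thesis
      proof cases
        case 1
        then have "x = 0" "y = 0"
          using key by (simp_all add: sum_power2_eq_zero_iff)
        then show ?thesis by simp
      next
        case 2
        then have "(s\<^sup>2 - 1) * d\<^sup>2 = (cmod x)\<^sup>2 + (cmod y)\<^sup>2 + 2 * (cmod x * cmod y)"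
          using key nxy by (simp add: algebra_simps)
        then have *: "(s\<^sup>2 - 1) * d\<^sup>2 = (cmod x + cmod y)\<^sup>2"
          by (simp add: power2_sum)
        have "- ((complex_of_real d)\<^sup>2) * (x * y / (t\<^sup>2 + x * y)) = complex_of_real ((s\<^sup>2 - 1) * d\<^sup>2)"
        proof -
          have "x * y / b\<^sup>2 = complex_of_real (1 - s\<^sup>2)" using xy b0 by simp
          then show ?thesis unfolding b2[symmetric] by (simp only:) (simp add: algebra_simps)
        qed
        then show ?thesis unfolding * using b0 b2 by auto
      next
        case 3
        \<comment> \<open>For s^2 < 1 the equations would make the square of |x| - |y| negative, so
          there is no solution.\<close>
        have "(cmod x + - cmod y)\<^sup>2 + (1 - s\<^sup>2) * d\<^sup>2 = 0"
          using key nxy 3 by (simp add: power2_eq_square algebra_simps)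
        moreover have "(1 - s\<^sup>2) * d\<^sup>2 > 0" using 3 d0 by simp
        ultimately show ?thesis
          using zero_le_power2[of "cmod x + - cmod y"] by linarith
      qed
    qed
  qed
next
  have diag: "discriminant_is_square d t x y" if "x = 0" "y = 0"
    unfolding discriminant_is_square_def using that
    by (intro exI[of _ d] exI[of _ t]) simp
  assume "?N \<or> ?S \<or> ?T"
  then consider ?N | ?S | ?T by blast
  then show "discriminant_is_square d t x y"
  proof cases
    case 1
    show ?thesis
    proof (cases "x = 0")
      case True
      then show ?thesis using 1 diag by simp
    next
      case False
      then have d0: "d = 0" using 1 by simp
      have "2 * cmod (t\<^sup>2 + x * y) = 2 * (cmod t)\<^sup>2 + (cmod x)\<^sup>2 + (cmod y)\<^sup>2"
      proof (cases "t = 0")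
        case True
        then show ?thesis using 1 by (simp add: norm_mult power2_eq_square)
      next
        case t0: False
        \<comment> \<open>Multiplying by |t|^2 lets \<open>t * cnj y = cnj t * x\<close> act on the
          product x y; cancelling |t|^2 then gives |t^2 + x y| = |t|^2 + |y|^2.\<close>
        have "(t * cnj t) * (t\<^sup>2 + x * y) = t\<^sup>2 * (t * cnj t) + (cnj t * x) * (t * y)"
          by (simp add: algebra_simps)
        also have "\<dots> = t\<^sup>2 * (t * cnj t + y * cnj y)"
          using 1 by (simp add: algebra_simps power2_eq_square)
        finally have "(t * cnj t) * (t\<^sup>2 + x * y) = t\<^sup>2 * (t * cnj t + y * cnj y)" .
        then have "complex_of_real ((cmod t)\<^sup>2) * (t\<^sup>2 + x * y) =
            t\<^sup>2 * complex_of_real ((cmod t)\<^sup>2 + (cmod y)\<^sup>2)"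
          by (simp add: complex_norm_square[symmetric])
        then have "cmod (complex_of_real ((cmod t)\<^sup>2)) * cmod (t\<^sup>2 + x * y) =
            (cmod t)\<^sup>2 * cmod (complex_of_real ((cmod t)\<^sup>2 + (cmod y)\<^sup>2))"
          by (metis norm_mult norm_power)
        then have "(cmod t)\<^sup>2 * cmod (t\<^sup>2 + x * y) = (cmod t)\<^sup>2 * ((cmod t)\<^sup>2 + (cmod y)\<^sup>2)"
          unfolding norm_of_real by simp
        then show ?thesis using t0 1 by simp
      qed
      then show ?thesis unfolding discriminant_is_square_def
        by (intro exI[of _ 0] exI[of _ "csqrt (t\<^sup>2 + x * y)"]) (simp add: d0 norm_csqrt)
    qed
  next
    case 2
    then have "d = 0 \<or> t = 0" by auto
    \<comment> \<open>With b = 0 the second equation reads d t = 0, and the third one determines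
      \<open>a\<close> up to sign.\<close>
    with 2 show ?thesis unfolding discriminant_is_square_def
      by (intro exI[of _ "sqrt (d\<^sup>2 + 2 * (cmod t)\<^sup>2 + (cmod x)\<^sup>2 + (cmod y)\<^sup>2)"] exI[of _ 0]) auto
  next
    case 3
    show ?thesis
    proof (cases "d = 0 \<or> x = 0 \<or> y = 0")
      case True
      then have "complex_of_real ((cmod x + cmod y)\<^sup>2) = 0" using 3 by auto
      then have "cmod x + cmod y = 0" unfolding of_real_eq_0_iff by simp
      then have "x = 0" "y = 0"
        using norm_ge_zero[of x] norm_ge_zero[of y] by (simp_all add: add_nonneg_eq_0_iff)
      then show ?thesis by (rule diag)
    next
      case False
      define b where "b = csqrt (t\<^sup>2 + x * y)"
      have b2: "b\<^sup>2 = t\<^sup>2 + x * y" by (simp add: b_def)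
      then have b0: "b \<noteq> 0" using 3 by auto
      \<comment> \<open>This is s^2 - 1 in the notation of the other direction, read off from (iii).
        Below, \<open>r'\<close> is the real ratio t / b with its sign, and the witness for
        \<open>a\<close> is r' d.\<close>
      define s where "s = ((cmod x + cmod y) / d)\<^sup>2"
      have s0: "s \<ge> 0" by (simp add: s_def)
      have "- ((complex_of_real d)\<^sup>2) * (x * y / b\<^sup>2) = complex_of_real ((cmod x + cmod y)\<^sup>2)"
        using 3 b2 by simp
      then have xy: "x * y = - s * b\<^sup>2"
        using False b0 unfolding s_def by (simp add: field_simps) (metis add.inverse_inverse)
      have t2: "t\<^sup>2 = (1 + s) * b\<^sup>2" using b2 xy by (simp add: algebra_simps)
      define r where "r = sqrt (1 + s)"
      have r2: "r\<^sup>2 = 1 + s" using s0 by (simp add: r_def)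
      have "t\<^sup>2 = (r * b)\<^sup>2" unfolding power_mult_distrib of_real_power[symmetric] r2 t2 by simp
      then have "t = r * b \<or> t = - (r * b)" by (simp add: power2_eq_iff)
      then obtain r' :: real where r': "t = r' * b" "r'\<^sup>2 = 1 + s"
        using r2 by (metis mult_minus_left of_real_minus power2_minus)
      have sd: "s * d\<^sup>2 = (cmod x + cmod y)\<^sup>2" using False by (simp add: s_def power_divide)
      have "cmod (x * y) = \<bar>- s\<bar> * (cmod b)\<^sup>2" unfolding xy by (simp add: norm_mult norm_power)
      then have nxy: "cmod x * cmod y = s * (cmod b)\<^sup>2" using s0 by (simp add: norm_mult)
      have nt: "(cmod t)\<^sup>2 = (1 + s) * (cmod b)\<^sup>2"
        unfolding r'(1) using r'(2) by (simp add: norm_mult power_mult_distrib)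
      have "(r' * d)\<^sup>2 + 2 * (cmod b)\<^sup>2 = d\<^sup>2 + 2 * (cmod t)\<^sup>2 + (cmod x)\<^sup>2 + (cmod y)\<^sup>2"
        unfolding nt power_mult_distrib r'(2) using sd nxy
        by (simp add: power2_sum algebra_simps)
      then show ?thesis unfolding discriminant_is_square_def
        by (intro exI[of _ "r' * d"] exI[of _ b]) (simp add: b2 r')
    qed
  qed
qed

section \<open>Sesquilinear expansion of quadratic forms\<close>

lemma carrier_vec_add_smult:
  fixes x y :: "'a :: comm_ring_1 vec"
  assumes "x \<in> carrier_vec n" "y \<in> carrier_vec n"
  shows "p \<cdot>\<^sub>v x + q \<cdot>\<^sub>v y \<in> carrier_vec n"
  using assms by simp

lemma cscalar_prod_add_smult_left:
  fixes x y z :: "complex vec"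
  assumes "x \<in> carrier_vec n" "y \<in> carrier_vec n" "z \<in> carrier_vec n"
  shows "(p \<cdot>\<^sub>v x + q \<cdot>\<^sub>v y) \<bullet>c z = p * (x \<bullet>c z) + q * (y \<bullet>c z)"
  using assms by (simp add: add_scalar_prod_distrib[of _ n])

lemma cscalar_prod_add_smult_right:
  fixes x y z :: "complex vec"
  assumes "x \<in> carrier_vec n" "y \<in> carrier_vec n" "z \<in> carrier_vec n"
  shows "z \<bullet>c (p \<cdot>\<^sub>v x + q \<cdot>\<^sub>v y) = cnj p * (z \<bullet>c x) + cnj q * (z \<bullet>c y)"
  using assms
  by (simp add: conjugate_add_vec[of _ n] conjugate_smult_vec scalar_prod_add_distrib[of _ n])

lemma mult_mat_vec_add_smult:
  fixes A :: "complex mat"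
  assumes "A \<in> carrier_mat m n" "x \<in> carrier_vec n" "y \<in> carrier_vec n"
  shows "A *\<^sub>v (p \<cdot>\<^sub>v x + q \<cdot>\<^sub>v y) = p \<cdot>\<^sub>v (A *\<^sub>v x) + q \<cdot>\<^sub>v (A *\<^sub>v y)"
  using assms by (simp add: mult_add_distrib_mat_vec[of _ m n] mult_mat_vec[of _ m n])

lemma cscalar_prod_self_add_smult:
  fixes x y :: "complex vec"
  assumes "x \<in> carrier_vec n" "y \<in> carrier_vec n"
  shows "(p \<cdot>\<^sub>v x + q \<cdot>\<^sub>v y) \<bullet>c (p \<cdot>\<^sub>v x + q \<cdot>\<^sub>v y) =
    p * cnj p * (x \<bullet>c x) + p * cnj q * (x \<bullet>c y) + q * cnj p * (y \<bullet>c x) + q * cnj q * (y \<bullet>c y)"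
  using assms carrier_vec_add_smult[OF assms]
  by (simp add: cscalar_prod_add_smult_left[of _ n] cscalar_prod_add_smult_right[of _ n] algebra_simps
      del: conjugate_square_eq_0_vec)

lemma quadratic_form_add_smult:
  fixes A :: "complex mat"
  assumes "A \<in> carrier_mat n n" "x \<in> carrier_vec n" "y \<in> carrier_vec n"
  shows "(A *\<^sub>v (p \<cdot>\<^sub>v x + q \<cdot>\<^sub>v y)) \<bullet>c (p \<cdot>\<^sub>v x + q \<cdot>\<^sub>v y) =
    p * cnj p * ((A *\<^sub>v x) \<bullet>c x) + p * cnj q * ((A *\<^sub>v x) \<bullet>c y)
    + q * cnj p * ((A *\<^sub>v y) \<bullet>c x) + q * cnj q * ((A *\<^sub>v y) \<bullet>c y)"
  using assms carrier_vec_add_smult[OF assms(2,3)] mult_mat_vec_carrier[OF assms(1,2)]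
    mult_mat_vec_carrier[OF assms(1,3)]
  by (simp add: mult_mat_vec_add_smult[of _ n n] cscalar_prod_add_smult_left[of _ n]
      cscalar_prod_add_smult_right[of _ n]) (simp add: algebra_simps)

lemma quadratic_form_smult:
  fixes A :: "complex mat"
  assumes "A \<in> carrier_mat n n" "x \<in> carrier_vec n"
  shows "(A *\<^sub>v (p \<cdot>\<^sub>v x)) \<bullet>c (p \<cdot>\<^sub>v x) = (cmod p)\<^sup>2 * ((A *\<^sub>v x) \<bullet>c x)"
  using assms
  by (simp add: mult_mat_vec[of _ n n] conjugate_smult_vec complex_norm_square del: of_real_power)

lemma cscalar_prod_self:
  fixes x :: "complex vec"
  assumes "x \<in> carrier_vec n"
  shows "x \<bullet>c x = (\<Sum>i<n. (cmod (x $ i))\<^sup>2)"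
  using assms
  by (simp add: scalar_prod_def complex_norm_square lessThan_atLeast0 del: of_real_power)

lemma cscalar_prod_swap:
  fixes x y :: "complex vec"
  assumes "x \<in> carrier_vec n" "y \<in> carrier_vec n"
  shows "y \<bullet>c x = cnj (x \<bullet>c y)"
  using assms by (simp add: scalar_prod_def mult.commute)

section \<open>Compactness and convexity of the numerical range\<close>

text \<open>Vectors are transcribed as functions on all of \<open>nat\<close> that vanish from
  \<open>n\<close> on, so that the product topology applies. The discs only restate a consequence of
  having norm 1, in the shape of a product of compact sets.\<close>

lemma numerical_range_altdef:
  assumes "A \<in> carrier_mat n n"
  shows "numerical_range A = (\<lambda>f. \<Sum>i<n. (\<Sum>j<n. A $$ (i,j) * f j) * cnj (f i)) `
    ((\<Pi>\<^sub>E i\<in>UNIV. if i < n then cball 0 1 else {0}) \<inter> {f. (\<Sum>i<n. (cmod (f i))\<^sup>2) = 1})"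
    (is "_ = ?F ` ?S")
proof -
  have eq: "(A *\<^sub>v x) \<bullet>c x = ?F f"
    if "x \<in> carrier_vec n" "\<And>i. i < n \<Longrightarrow> x $ i = f i" for x f
    using assms that by (auto simp: scalar_prod_def lessThan_atLeast0 intro!: sum.cong)
  have nrm: "x \<bullet>c x = (\<Sum>i<n. (cmod (f i))\<^sup>2)"
    if "x \<in> carrier_vec n" "\<And>i. i < n \<Longrightarrow> x $ i = f i" for x f
    unfolding cscalar_prod_self[OF that(1)] using that(2) by simp
  show ?thesis
  proof (intro equalityI subsetI)
    fix z assume "z \<in> numerical_range A"
    then obtain x where x: "x \<in> carrier_vec n" "x \<bullet>c x = 1" "z = (A *\<^sub>v x) \<bullet>c x"
      using assms by (auto simp: numerical_range_def)
    define f where "f = (\<lambda>i. if i < n then x $ i else 0)"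
    have f: "\<And>i. i < n \<Longrightarrow> x $ i = f i" by (simp add: f_def)
    have "complex_of_real (\<Sum>i<n. (cmod (f i))\<^sup>2) = 1"
      using nrm[OF x(1) f] x(2) by simp
    then have s: "(\<Sum>i<n. (cmod (f i))\<^sup>2) = 1" unfolding of_real_eq_1_iff .
    have "cmod (f i) \<le> 1" if "i < n" for i
    proof -
      have "(cmod (f i))\<^sup>2 \<le> (\<Sum>i<n. (cmod (f i))\<^sup>2)"
        using that by (intro member_le_sum) auto
      then have "(cmod (f i))\<^sup>2 \<le> 1\<^sup>2" using s by simp
      then show ?thesis by (rule power2_le_imp_le) simp
    qed
    then have "f \<in> ?S" using s by (auto simp: f_def)
    then have "?F f \<in> ?F ` ?S" by (rule imageI)
    moreover have "z = ?F f" using eq[OF x(1), of f] f x(3) by blast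
    ultimately show "z \<in> ?F ` ?S" by simp
  next
    fix z assume "z \<in> ?F ` ?S"
    then obtain f where f: "(\<Sum>i<n. (cmod (f i))\<^sup>2) = 1" "z = ?F f" by blast
    have "vec n f \<bullet>c vec n f = 1" "(A *\<^sub>v vec n f) \<bullet>c vec n f = z"
      using nrm[of "vec n f" f] eq[of "vec n f" f] f by simp_all
    then show "z \<in> numerical_range A"
      using assms unfolding numerical_range_def by (auto intro!: exI[of _ "vec n f"])
  qed
qed

text \<open>By Tychonoff the product of discs is compact; the sphere is closed in it, and the form
  is continuous in finitely many coordinates.\<close>

lemma compact_numerical_range:
  assumes "A \<in> carrier_mat n n"
  shows "compact (numerical_range A)"
  unfolding numerical_range_altdef[OF assms]
proof (intro compact_continuous_image compact_Int_closed)
  let ?K = "\<lambda>i. if i < n then cball 0 1 else {0 :: complex}"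
  have "compactin (product_topology (\<lambda>_. euclidean) UNIV) (\<Pi>\<^sub>E i\<in>UNIV. ?K i)"
    unfolding compactin_PiE by auto
  then show "compact (\<Pi>\<^sub>E i\<in>UNIV. ?K i)"
    unfolding euclidean_product_topology by simp
  have "continuous_on UNIV (\<lambda>f :: nat \<Rightarrow> complex. \<Sum>i<n. (cmod (f i))\<^sup>2)"
    by (intro continuous_intros continuous_on_product_coordinates)
  then show "closed {f :: nat \<Rightarrow> complex. (\<Sum>i<n. (cmod (f i))\<^sup>2) = 1}"
    by (intro closed_Collect_eq) auto
  show "continuous_on S (\<lambda>f. \<Sum>i<n. (\<Sum>j<n. A $$ (i,j) * f j) * cnj (f i))" for S
    by (intro continuous_intros continuous_on_subset[OF continuous_on_product_coordinates]) auto
qed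

text \<open>The imaginary part equals that of \<mu> (s - cnj t), so \<mu> has to cancel the phase of
  s - cnj t.\<close>

lemma unit_rotation_to_real:
  obtains \<mu> :: complex where "cmod \<mu> = 1" "Im (\<mu> * s + cnj \<mu> * t) = 0"
proof (cases "s = cnj t")
  case True
  then show thesis by (intro that[of 1]) auto
next
  case False
  define d where "d = s - cnj t"
  have d: "d \<noteq> 0" using False by (simp add: d_def)
  let ?m = "cnj d / cmod d"
  have "Im (m * s + cnj m * t) = Im (m * d)" for m
    by (simp add: d_def algebra_simps)
  from this[of ?m] have "Im (?m * s + cnj ?m * t) = Im (?m * d)" .
  also have "?m * d = complex_of_real (cmod d)"
    using d complex_norm_square[of d] by (simp add: field_simps power2_eq_square)
  finally show thesis using d by (intro that[of ?m]) (simp_all add: norm_divide)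
qed

text \<open>For unit vectors with values \<open>a \<noteq> b\<close>, rotating \<open>x\<close> by \<open>\<mu>\<close> makes the cross term of
  \<open>(A - a) / (b - a)\<close> real, so that its values along the segment from \<open>\<mu> x\<close> to \<open>y\<close>
  are real and run from 0 to 1.\<close>
lemma toeplitz_hausdorff:
  assumes A: "A \<in> carrier_mat n n"
  shows "convex (numerical_range A)"
proof (rule convexI)
  fix a b :: complex and u' u :: real
  assume a: "a \<in> numerical_range A" and b: "b \<in> numerical_range A"
    and u: "0 \<le> u'" "0 \<le> u" "u' + u = 1"
  from a b obtain x y where x: "x \<in> carrier_vec n" "x \<bullet>c x = 1" "a = (A *\<^sub>v x) \<bullet>c x"
      and y: "y \<in> carrier_vec n" "y \<bullet>c y = 1" "b = (A *\<^sub>v y) \<bullet>c y"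
    using A by (auto simp: numerical_range_def)
  show "u' *\<^sub>R a + u *\<^sub>R b \<in> numerical_range A"
  proof (cases "a = b")
    case True
    then have "u' *\<^sub>R a + u *\<^sub>R b = (u' + u) *\<^sub>R a" by (simp only: scaleR_left_distrib)
    then show ?thesis using a unfolding u(3) by simp
  next
    case False
    define k where "k = x \<bullet>c y"
    define s where "s = ((A *\<^sub>v x) \<bullet>c y - a * k) / (b - a)"
    define t where "t = ((A *\<^sub>v y) \<bullet>c x - a * cnj k) / (b - a)"
    have s: "(A *\<^sub>v x) \<bullet>c y = a * k + (b - a) * s" and t: "(A *\<^sub>v y) \<bullet>c x = a * cnj k + (b - a) * t"
      using False by (simp_all add: s_def t_def)
    obtain \<mu> where \<mu>: "cmod \<mu> = 1" "Im (\<mu> * s + cnj \<mu> * t) = 0"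
      by (rule unit_rotation_to_real)
    define r where "r = Re (\<mu> * s + cnj \<mu> * t)"
    have r: "\<mu> * s + cnj \<mu> * t = complex_of_real r"
      using \<mu>(2) by (simp add: r_def complex_eq_iff)
    have mm: "\<mu> * cnj \<mu> = 1" using \<mu>(1) by (simp add: complex_norm_square[symmetric])
    define N where "N = (\<lambda>\<tau> :: real. (1 - \<tau>)\<^sup>2 + \<tau>\<^sup>2 + 2 * (1 - \<tau>) * \<tau> * Re (\<mu> * k))"
    define z where "z = (\<lambda>\<tau> :: real. ((1 - \<tau>) * \<mu>) \<cdot>\<^sub>v x + complex_of_real \<tau> \<cdot>\<^sub>v y)"
    have zc: "z \<tau> \<in> carrier_vec n" for \<tau> using x y by (simp add: z_def)
    have zz: "z \<tau> \<bullet>c z \<tau> = N \<tau>" for \<tau>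
    proof -
      have yx: "y \<bullet>c x = cnj k" using cscalar_prod_swap[OF x(1) y(1)] by (simp add: k_def)
      have "z \<tau> \<bullet>c z \<tau> = (1 - \<tau>)\<^sup>2 * (\<mu> * cnj \<mu>) + \<tau>\<^sup>2 + (1 - \<tau>) * \<tau> * (\<mu> * k + cnj (\<mu> * k))"
        unfolding z_def cscalar_prod_self_add_smult[OF x(1) y(1)] x(2) y(2) yx k_def[symmetric]
        by (simp add: algebra_simps power2_eq_square)
      then show ?thesis unfolding mm complex_add_cnj N_def by (simp del: times_complex.sel)
    qed
    have Az: "(A *\<^sub>v z \<tau>) \<bullet>c z \<tau> = a * N \<tau> + (b - a) * (\<tau>\<^sup>2 + (1 - \<tau>) * \<tau> * r)" for \<tau>
    proof -
      have "(A *\<^sub>v z \<tau>) \<bullet>c z \<tau> = a * ((1 - \<tau>)\<^sup>2 * (\<mu> * cnj \<mu>) + \<tau>\<^sup>2 + (1 - \<tau>) * \<tau> * (\<mu> * k + cnj (\<mu> * k)))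
          + (b - a) * (\<tau>\<^sup>2 + (1 - \<tau>) * \<tau> * (\<mu> * s + cnj \<mu> * t))"
        unfolding z_def quadratic_form_add_smult[OF A x(1) y(1)] s t x(3)[symmetric] y(3)[symmetric]
        by (simp add: algebra_simps power2_eq_square)
      then show ?thesis unfolding mm complex_add_cnj N_def r by (simp del: times_complex.sel)
    qed
    \<comment> \<open>The normalised vector \<open>z \<tau>\<close> has the value a + (b - a)
      (\<tau>^2 + (1 - \<tau>) \<tau> r) / N \<tau>, so a zero of \<open>g\<close> is a parameter at
      which the weight of \<open>b\<close> is exactly \<open>u\<close>.\<close>
    define g where "g = (\<lambda>\<tau> :: real. \<tau>\<^sup>2 + (1 - \<tau>) * \<tau> * r - u * N \<tau>)"
    have "\<exists>\<tau>\<ge>0. \<tau> \<le> 1 \<and> g \<tau> = 0"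
    proof (rule IVT')
      show "g 0 \<le> 0" "0 \<le> g 1" using u by (simp_all add: g_def N_def)
      show "continuous_on {0..1} g" unfolding g_def N_def by (intro continuous_intros)
    qed simp
    then obtain \<tau> where \<tau>: "g \<tau> = 0" by blast
    \<comment> \<open>If it vanished, \<open>x\<close> and \<open>y\<close> would be parallel:
      comparing norms (\<open>e\<close> at the identity) gives \<tau> = 1/2, and comparing values of
      the form (\<open>e\<close> at \<open>A\<close>) then gives a = b.\<close>
    have "z \<tau> \<noteq> 0\<^sub>v n"
    proof
      assume z0: "z \<tau> = 0\<^sub>v n"
      have "((1 - \<tau>) * \<mu>) \<cdot>\<^sub>v x = complex_of_real (- \<tau>) \<cdot>\<^sub>v y"
      proof (rule eq_vecI)
        fix i assume "i < dim_vec (complex_of_real (- \<tau>) \<cdot>\<^sub>v y)"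
        then have i: "i < n" using y by simp
        have "z \<tau> $ i = 0" using z0 i by simp
        then show "(((1 - \<tau>) * \<mu>) \<cdot>\<^sub>v x) $ i = (complex_of_real (- \<tau>) \<cdot>\<^sub>v y) $ i"
          using i x y by (simp add: z_def add_eq_0_iff)
      qed (use x y in simp)
      then have e: "(B *\<^sub>v (((1 - \<tau>) * \<mu>) \<cdot>\<^sub>v x)) \<bullet>c (((1 - \<tau>) * \<mu>) \<cdot>\<^sub>v x)
          = (B *\<^sub>v (complex_of_real (- \<tau>) \<cdot>\<^sub>v y)) \<bullet>c (complex_of_real (- \<tau>) \<cdot>\<^sub>v y)" for B
        by simp
      have "(1 - \<tau>)\<^sup>2 * a = \<tau>\<^sup>2 * b"
        using e[of A] unfolding quadratic_form_smult[OF A x(1)] quadratic_form_smult[OF A y(1)]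
        using x y \<mu> by (simp add: norm_mult del: of_real_diff flip: of_real_power)
      moreover have "complex_of_real ((1 - \<tau>)\<^sup>2) = complex_of_real (\<tau>\<^sup>2)"
        using e[of "1\<^sub>m n"] unfolding quadratic_form_smult[OF one_carrier_mat x(1)]
          quadratic_form_smult[OF one_carrier_mat y(1)]
        using x y \<mu> by (simp add: norm_mult del: of_real_diff flip: of_real_power)
      then have "(1 - \<tau>)\<^sup>2 = \<tau>\<^sup>2" unfolding of_real_eq_iff .
      then have "\<tau> = 1 / 2" by (simp add: power2_eq_square algebra_simps)
      ultimately show False using False by simp
    qed
    then have "z \<tau> \<bullet>c z \<tau> > 0" unfolding conjugate_square_greater_0_vec[OF zc] .
    then have N0: "N \<tau> > 0" unfolding zz by (simp add: less_complex_def)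
    let ?v = "complex_of_real (1 / sqrt (N \<tau>)) \<cdot>\<^sub>v z \<tau>"
    have c: "(cmod (complex_of_real (1 / sqrt (N \<tau>))))\<^sup>2 = 1 / N \<tau>"
      using N0 unfolding norm_of_real by (simp add: power_divide)
    have "?v \<bullet>c ?v = 1"
      using quadratic_form_smult[OF one_carrier_mat zc, of "complex_of_real (1 / sqrt (N \<tau>))" \<tau>] zc N0
      unfolding c by (simp add: zz)
    moreover have "(A *\<^sub>v ?v) \<bullet>c ?v = u' *\<^sub>R a + u *\<^sub>R b"
    proof -
      have "\<tau>\<^sup>2 + (1 - \<tau>) * \<tau> * r = u * N \<tau>" using \<tau> by (simp add: g_def)
      then have "(A *\<^sub>v z \<tau>) \<bullet>c z \<tau> = a * N \<tau> + (b - a) * complex_of_real (u * N \<tau>)"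
        unfolding Az by (metis of_real_add of_real_diff of_real_mult of_real_power of_real_1)
      then have "(A *\<^sub>v ?v) \<bullet>c ?v = a + (b - a) * u"
        unfolding quadratic_form_smult[OF A zc] c using N0 by (simp add: field_simps)
      also have "\<dots> = u' *\<^sub>R a + u *\<^sub>R b"
      proof -
        have u': "u' = 1 - u" using u by simp
        show ?thesis unfolding u' by (simp add: scaleR_conv_of_real algebra_simps)
      qed
      finally show ?thesis .
    qed
    ultimately show ?thesis
      using A zc unfolding numerical_range_def
      by (intro CollectI exI[of _ ?v]) auto
  qed
qed

section \<open>Support functions of plane sets\<close>

text \<open>The value of the support function of \<open>S\<close> in the direction
  \<open>cnj w\<close>, with the maximum attained. The relational form avoids suprema and side
  conditions for their existence.\<close>

definition attains_support :: "complex set \<Rightarrow> complex \<Rightarrow> real \<Rightarrow> bool" where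
  "attains_support S w s \<longleftrightarrow> (\<forall>z\<in>S. Re (w * z) \<le> s) \<and> (\<exists>z\<in>S. Re (w * z) = s)"

lemma attains_support_unique:
  "attains_support S w s \<Longrightarrow> attains_support S w s' \<Longrightarrow> s = s'"
  unfolding attains_support_def by (metis order.antisym)

lemma convex_Re_mult_less: "convex {z. Re (w * z) < s}" "convex {z. Re (w * z) \<le> s}"
proof -
  have "Re (w * z) = inner (cnj w) z" for z by (simp add: inner_complex_def)
  then show "convex {z. Re (w * z) < s}" "convex {z. Re (w * z) \<le> s}"
    by (simp_all add: convex_halfspace_lt convex_halfspace_le del: times_complex.sel)
qed

text \<open>Otherwise every member lies in the open half-plane Re (w z) < s; this half-plane is
  convex, so it contains the hull as well, and \<open>s\<close> is not attained.\<close>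

lemma attains_support_convex_hull_UnionD:
  assumes "attains_support (convex hull (\<Union>\<E>)) w s"
    and "\<And>S. S \<in> \<E> \<Longrightarrow> \<exists>r. attains_support S w r"
  shows "\<exists>S\<in>\<E>. attains_support S w s"
proof (rule ccontr)
  assume none: "\<not> ?thesis"
  have "\<Union>\<E> \<subseteq> {z. Re (w * z) < s}"
  proof
    fix z assume "z \<in> \<Union>\<E>"
    then obtain S where S: "S \<in> \<E>" "z \<in> S" by blast
    then obtain r where r: "attains_support S w r" using assms(2) by blast
    have "S \<subseteq> convex hull (\<Union>\<E>)" using S(1) hull_subset by fast
    then have "r \<le> s" using r assms(1) unfolding attains_support_def by blast
    moreover have "r \<noteq> s" using none r S(1) by blast
    moreover have "Re (w * z) \<le> r" using r S(2) unfolding attains_support_def by blast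
    ultimately show "z \<in> {z. Re (w * z) < s}" by (simp del: times_complex.sel)
  qed
  then have "convex hull (\<Union>\<E>) \<subseteq> {z. Re (w * z) < s}"
    by (intro hull_minimal convex_Re_mult_less)
  then show False using assms(1) unfolding attains_support_def by fastforce
qed

lemma attains_support_convex_hull_Un:
  assumes "attains_support S w s" "attains_support T w t"
  shows "attains_support (convex hull (S \<union> T)) w (max s t)"
proof -
  have "S \<union> T \<subseteq> {z. Re (w * z) \<le> max s t}"
    using assms unfolding attains_support_def by fastforce
  then have "convex hull (S \<union> T) \<subseteq> {z. Re (w * z) \<le> max s t}"
    by (intro hull_minimal convex_Re_mult_less)
  moreover have "\<exists>z\<in>S \<union> T. Re (w * z) = max s t"
    using assms unfolding attains_support_def max_def by (metis UnCI)
  ultimately show ?thesis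
    unfolding attains_support_def using hull_subset[of "S \<union> T" convex] by blast
qed

text \<open>A point outside a closed convex set is strictly separated from it by a line, and in the
  direction normal to that line the two support values would differ.\<close>

lemma subset_of_attains_support:
  assumes "closed T" "convex T"
    and "\<And>w. cmod w = 1 \<Longrightarrow> \<exists>s. attains_support S w s \<and> attains_support T w s"
  shows "S \<subseteq> T"
proof
  fix z assume z: "z \<in> S"
  show "z \<in> T"
  proof (rule ccontr)
    assume "z \<notin> T"
    then obtain a b where ab: "inner a z < b" "\<And>x. x \<in> T \<Longrightarrow> b < inner a x"
      using separating_hyperplane_closed_point[OF assms(2,1)] by blast
    have "\<exists>x. x \<in> T" using assms(3)[of 1] unfolding attains_support_def by auto
    with ab have a0: "a \<noteq> 0" by fastforce
    \<comment> \<open>Chosen so that Re (w x) is - inner a x / |a|: the lower bound for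
      \<open>inner a\<close> on \<open>T\<close> becomes an upper bound in the direction
      \<open>w\<close>.\<close>
    define w where "w = - cnj a / cmod a"
    have Rew: "Re (w * x) = - inner a x / cmod a" for x
      unfolding w_def inner_complex_def by (simp add: diff_divide_distrib add_divide_distrib)
    have "cmod w = 1" using a0 by (simp add: w_def norm_divide)
    then obtain s where s: "attains_support S w s" "attains_support T w s" using assms(3) by blast
    then obtain x where x: "x \<in> T" "Re (w * x) = s" unfolding attains_support_def by blast
    have "Re (w * z) \<le> Re (w * x)"
      unfolding x(2) using s(1) z by (simp add: attains_support_def del: times_complex.sel)
    then have "inner a x \<le> inner a z"
      using a0 unfolding Rew by (simp add: divide_le_cancel)
    then show False using ab(1) ab(2)[OF x(1)] by linarith
  qed
qed

section \<open>Ellipses and their support functions\<close>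

text \<open>The set from \<open>is_ellipse_centered_at\<close>, freed from the ordering of the
  semi-axes.\<close>

definition ellipse :: "complex \<Rightarrow> real \<Rightarrow> real \<Rightarrow> real \<Rightarrow> complex set" where
  "ellipse c a b \<phi> = range (\<lambda>t :: real. c + cis \<phi> * Complex (a * cos t) (b * sin t))"

lemma ellipse_altdef:
  "ellipse c a b \<phi> = (\<lambda>z. c + cis \<phi> * Complex (a * Re z) (b * Im z)) ` sphere 0 1"
proof -
  have "sphere 0 1 = range cis"
  proof (intro equalityI subsetI)
    fix z :: complex assume "z \<in> sphere 0 1"
    then have "z = cis (Arg z)" using rcis_cmod_Arg[of z] by (simp add: rcis_def)
    then show "z \<in> range cis" by blast
  qed auto
  then show ?thesis unfolding ellipse_def by (simp add: image_image)
qed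

lemma compact_ellipse: "compact (ellipse c a b \<phi>)"
proof -
  have "continuous_on (sphere 0 1) (\<lambda>z. c + cis \<phi> * (complex_of_real (a * Re z) + \<i> * complex_of_real (b * Im z)))"
    by (intro continuous_intros)
  then show ?thesis unfolding ellipse_altdef Complex_eq
    by (intro compact_continuous_image) auto
qed

text \<open>For v = w cis \<phi>, pairing with an ellipse point turns into Re (m z) with z on the
  unit circle and m = a Re v + i b Im v. The maximum is |m|, and the double angle formula rewrites
  |m|^2 in terms of v^2.\<close>

lemma attains_support_ellipse:
  assumes "cmod w = 1"
  shows "attains_support (ellipse c a b \<phi>) w
    (Re (w * c) + sqrt ((a\<^sup>2 + b\<^sup>2) / 2 + Re (w\<^sup>2 * (complex_of_real ((a\<^sup>2 - b\<^sup>2) / 2) * (cis \<phi>)\<^sup>2))))"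
proof -
  define v where "v = w * cis \<phi>"
  define m where "m = Complex (a * Re v) (b * Im v)"
  have "cmod v = 1" using assms by (simp add: v_def norm_mult)
  then have v: "(Re v)\<^sup>2 + (Im v)\<^sup>2 = 1" using cmod_power2[of v] by simp
  have "(a\<^sup>2 + b\<^sup>2) / 2 + Re (w\<^sup>2 * (complex_of_real ((a\<^sup>2 - b\<^sup>2) / 2) * (cis \<phi>)\<^sup>2))
      = (a\<^sup>2 + b\<^sup>2) / 2 + (a\<^sup>2 - b\<^sup>2) / 2 * Re (v\<^sup>2)"
  proof -
    have "w\<^sup>2 * (complex_of_real ((a\<^sup>2 - b\<^sup>2) / 2) * (cis \<phi>)\<^sup>2) = complex_of_real ((a\<^sup>2 - b\<^sup>2) / 2) * v\<^sup>2"
      by (simp add: v_def power_mult_distrib mult_ac)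
    then show ?thesis by (simp only: Re_complex_of_real Im_complex_of_real times_complex.sel mult_zero_left diff_zero)
  qed
  also have "\<dots> = (a\<^sup>2 + b\<^sup>2) / 2 * ((Re v)\<^sup>2 + (Im v)\<^sup>2) + (a\<^sup>2 - b\<^sup>2) / 2 * ((Re v)\<^sup>2 - (Im v)\<^sup>2)"
    unfolding v by (simp add: power2_eq_square)
  also have "\<dots> = (cmod m)\<^sup>2"
    unfolding cmod_power2 m_def by (simp add: field_simps power2_eq_square)
  finally have s: "sqrt ((a\<^sup>2 + b\<^sup>2) / 2 + Re (w\<^sup>2 * (complex_of_real ((a\<^sup>2 - b\<^sup>2) / 2) * (cis \<phi>)\<^sup>2))) = cmod m"
    by simp
  have pt: "Re (w * (c + cis \<phi> * Complex (a * Re z) (b * Im z))) = Re (w * c) + Re (m * z)" for z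
  proof -
    have *: "w * (c + cis \<phi> * Complex (a * Re z) (b * Im z)) = w * c + v * Complex (a * Re z) (b * Im z)"
      by (simp add: v_def algebra_simps)
    show ?thesis unfolding * m_def by (simp add: mult_ac)
  qed
  have "Re (m * z) \<le> cmod m" if "z \<in> sphere 0 1" for z
    using complex_Re_le_cmod[of "m * z"] that by (simp add: norm_mult del: times_complex.sel)
  moreover have "\<exists>z\<in>sphere 0 1. Re (m * z) = cmod m"
  proof (cases "m = 0")
    case True
    then show ?thesis by (intro bexI[of _ 1]) auto
  next
    case False
    have "m * (cnj m / cmod m) = complex_of_real (cmod m)"
      using False complex_norm_square[of m] by (simp add: field_simps power2_eq_square)
    then show ?thesis using False
      by (intro bexI[of _ "cnj m / cmod m"]) (simp_all add: norm_divide del: times_complex.sel)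
  qed
  ultimately show ?thesis
    unfolding attains_support_def ellipse_altdef s ball_simps bex_simps pt by auto
qed

lemma is_ellipse_attains_support:
  assumes "is_ellipse_centered_at c S"
  obtains u k where "cmod k \<le> u"
    "\<And>w. cmod w = 1 \<Longrightarrow> attains_support S w (Re (w * c) + sqrt (u + Re (w\<^sup>2 * k)))"
proof -
  from assms obtain a b \<phi> where ab: "0 \<le> b" "b \<le> a" "S = ellipse c a b \<phi>"
    by (auto simp: is_ellipse_centered_at_def ellipse_def)
  have "b\<^sup>2 \<le> a\<^sup>2" using ab by (simp add: power_mono)
  then have "cmod (complex_of_real ((a\<^sup>2 - b\<^sup>2) / 2) * (cis \<phi>)\<^sup>2) \<le> (a\<^sup>2 + b\<^sup>2) / 2"
    unfolding norm_mult norm_power norm_of_real by simp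
  then show thesis
    by (rule that[OF _ attains_support_ellipse[of _ c a b \<phi>, folded ab(3)]])
qed

text \<open>Solving u = (a^2 + b^2) / 2 and |k| = (a^2 - b^2) / 2 for the semi-axes; |k| <= u is
  exactly what makes the minor one real.\<close>

lemma ellipse_with_support:
  assumes "cmod k \<le> u"
  obtains S where "is_ellipse_centered_at c S" "compact S"
    "\<And>w. cmod w = 1 \<Longrightarrow> attains_support S w (Re (w * c) + sqrt (u + Re (w\<^sup>2 * k)))"
proof -
  let ?a = "sqrt (u + cmod k)" and ?b = "sqrt (u - cmod k)"
  let ?S = "ellipse c ?a ?b (Arg k / 2)"
  have sq: "?a\<^sup>2 = u + cmod k" "?b\<^sup>2 = u - cmod k"
    using assms norm_ge_zero[of k] by (simp_all del: norm_ge_zero)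
  have e: "(?a\<^sup>2 + ?b\<^sup>2) / 2 = u" "(?a\<^sup>2 - ?b\<^sup>2) / 2 = cmod k"
    unfolding sq by simp_all
  have cis: "complex_of_real (cmod k) * (cis (Arg k / 2))\<^sup>2 = k"
    using rcis_cmod_Arg[of k] by (simp add: rcis_def DeMoivre)
  have "is_ellipse_centered_at c ?S"
    unfolding is_ellipse_centered_at_def ellipse_def
    using assms norm_ge_zero[of k]
    by (intro exI[of _ ?a] exI[of _ ?b] exI[of _ "Arg k / 2"]) (simp del: norm_ge_zero)
  then show thesis
    using attains_support_ellipse[of _ c ?a ?b "Arg k / 2"] unfolding e cis
    by (intro that[of ?S] compact_ellipse)
qed

section \<open>Hulls of finitely many ellipses\<close>

text \<open>The expression is smallest where \<open>e\<close> turns \<open>k\<close> to the negative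
  real axis; its value there is u - |k|.\<close>

lemma cmod_le_of_Re_nonneg:
  assumes "\<And>e. cmod e = 1 \<Longrightarrow> 0 \<le> u + Re (e * k)"
  shows "cmod k \<le> u"
proof (cases "k = 0")
  case True
  then show ?thesis using assms[of 1] by simp
next
  case False
  have "- cnj k / cmod k * k = complex_of_real (- cmod k)"
    using False complex_norm_square[of k] by (simp add: field_simps power2_eq_square)
  then show ?thesis
    using assms[of "- cnj k / cmod k"] False by (simp add: norm_divide del: times_complex.sel)
qed

lemma infinite_unit_circle: "infinite {e :: complex. cmod e = 1}"
proof -
  have "inj_on cis {0..1 :: real}"
  proof (rule inj_onI)
    fix s t :: real assume st: "s \<in> {0..1}" "t \<in> {0..1}" "cis s = cis t"
    then have "cos s = cos t" by (simp add: cis.ctr)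
    moreover have "t \<le> pi" "s \<le> pi" using st(1,2) pi_ge_two unfolding atLeastAtMost_iff by linarith+
    ultimately show "s = t" using st(1,2) cos_inj_pi[of s t] by auto
  qed
  then have "infinite (cis ` {0..1 :: real})"
    using finite_imageD infinite_Icc[of 0 "1 :: real"] by fastforce
  moreover have "cis ` {0..1 :: real} \<subseteq> {e. cmod e = 1}" by auto
  ultimately show ?thesis using finite_subset by blast
qed

text \<open>The assumption \<open>nonneg\<close> concerns the smaller of the two branches; it is
  what makes both branches support functions of genuine ellipses.\<close>

proposition hull_of_ellipses_iff_discriminant_is_square:
  assumes "compact W" "convex W"
    and nonneg: "\<And>e. cmod e = 1 \<Longrightarrow> 0 \<le> c0 + Re (e * c1) - sqrt (trig_discriminant d t x y e) / 4"
    and supp: "\<And>w. cmod w = 1 \<Longrightarrow> attains_support W w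
      (Re (w * c) + sqrt (c0 + Re (w\<^sup>2 * c1) + sqrt (trig_discriminant d t x y (w\<^sup>2)) / 4))"
  shows "is_hull_of_ellipses_centered_at c W \<longleftrightarrow> discriminant_is_square d t x y"
proof
  let ?q = "trig_discriminant d t x y"
  have q0: "0 \<le> ?q e" for e by (simp add: trig_discriminant_def)
  assume "is_hull_of_ellipses_centered_at c W"
  then obtain \<E> where \<E>: "finite \<E>" "\<And>S. S \<in> \<E> \<Longrightarrow> is_ellipse_centered_at c S"
      "W = convex hull (\<Union>\<E>)"
    by (auto simp: is_hull_of_ellipses_centered_at_def)
  \<comment> \<open>\<open>csqrt e\<close> selects a unit w with w^2 = e; \<open>Q S e\<close> says
    that \<open>S\<close> touches the support line of \<open>W\<close> in that direction.\<close>
  define Q where "Q = (\<lambda>S e. attains_support S (csqrt e)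
      (Re (csqrt e * c) + sqrt (c0 + Re (e * c1) + sqrt (?q e) / 4)))"
  have "\<exists>S\<in>\<E>. Q S e" if "cmod e = 1" for e
  proof -
    have w: "cmod (csqrt e) = 1" using that by (simp add: norm_csqrt)
    have "\<exists>S\<in>\<E>. attains_support S (csqrt e)
        (Re (csqrt e * c) + sqrt (c0 + Re ((csqrt e)\<^sup>2 * c1) + sqrt (?q ((csqrt e)\<^sup>2)) / 4))"
    proof (rule attains_support_convex_hull_UnionD)
      show "attains_support (convex hull (\<Union>\<E>)) (csqrt e)
        (Re (csqrt e * c) + sqrt (c0 + Re ((csqrt e)\<^sup>2 * c1) + sqrt (?q ((csqrt e)\<^sup>2)) / 4))"
        using supp[OF w] unfolding \<E>(3) .
      show "\<exists>r. attains_support S (csqrt e) r" if "S \<in> \<E>" for S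
        using is_ellipse_attains_support[OF \<E>(2)[OF that]] w by metis
    qed
    then show ?thesis unfolding Q_def power2_csqrt .
  qed
  \<comment> \<open>Pigeonhole: infinitely many \<open>e\<close> are shared among finitely many
    ellipses.\<close>
  then have "\<exists>S\<in>\<E>. infinite {e \<in> {e. cmod e = 1}. Q S e}"
    by (intro pigeonhole_infinite_rel infinite_unit_circle \<E>(1)) blast
  then obtain S where S: "S \<in> \<E>" "infinite {e \<in> {e. cmod e = 1}. Q S e}" by blast
  obtain u k where uk: "cmod k \<le> u"
      "\<And>w. cmod w = 1 \<Longrightarrow> attains_support S w (Re (w * c) + sqrt (u + Re (w\<^sup>2 * k)))"
    using is_ellipse_attains_support[OF \<E>(2)[OF S(1)]] by metis
  \<comment> \<open>Equating the radicands of \<open>W\<close> and \<open>S\<close> isolates the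
    inner root as a trigonometric polynomial of degree 1.\<close>
  have *: "?q e = (4 * (u - c0) + 2 * Re (e * (2 * (k - c1))))\<^sup>2"
    if e: "e \<in> {e \<in> {e. cmod e = 1}. Q S e}" for e
  proof -
    have w: "cmod (csqrt e) = 1" using e by (simp add: norm_csqrt)
    have "Re (csqrt e * c) + sqrt (c0 + Re (e * c1) + sqrt (?q e) / 4)
        = Re (csqrt e * c) + sqrt (u + Re (e * k))"
      using attains_support_unique[OF _ uk(2)[OF w]] e unfolding Q_def power2_csqrt by blast
    then have "c0 + Re (e * c1) + sqrt (?q e) / 4 = u + Re (e * k)"
      by (simp del: times_complex.sel)
    then have "sqrt (?q e) = 4 * (u - c0) + 2 * Re (e * (2 * (k - c1)))"
      by (simp add: algebra_simps)
    then show ?thesis using q0[of e] by (metis real_sqrt_pow2)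
  qed
  show "discriminant_is_square d t x y"
    by (rule discriminant_is_squareI[OF S(2) _ *]) blast+
next
  assume "discriminant_is_square d t x y"
  then obtain a b where ab:
      "\<And>e. cmod e = 1 \<Longrightarrow> trig_discriminant d t x y e = (a + 2 * Re (e * b))\<^sup>2"
    by (rule discriminant_is_squareD) blast
  define p where "p = (\<lambda>e. a + 2 * Re (e * b))"
  have sq: "sqrt (trig_discriminant d t x y e) = \<bar>p e\<bar>" if "cmod e = 1" for e
    unfolding ab[OF that] p_def by simp
  \<comment> \<open>The branches with + p and - p in place of the inner root. Each is at least c0 +
    Re (e c1) - |p e| / 4, hence nonnegative.\<close>
  have 1: "c0 + a / 4 + Re (e * (c1 + b / 2)) = c0 + Re (e * c1) + p e / 4"
    and 2: "c0 - a / 4 + Re (e * (c1 - b / 2)) = c0 + Re (e * c1) - p e / 4" for e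
    by (simp_all add: p_def algebra_simps diff_divide_distrib)
  have "cmod (c1 + b / 2) \<le> c0 + a / 4" "cmod (c1 - b / 2) \<le> c0 - a / 4"
  proof -
    show "cmod (c1 + b / 2) \<le> c0 + a / 4"
    proof (rule cmod_le_of_Re_nonneg)
      fix e :: complex assume e: "cmod e = 1"
      show "0 \<le> c0 + a / 4 + Re (e * (c1 + b / 2))"
        using nonneg[OF e] unfolding sq[OF e] 1 by linarith
    qed
    show "cmod (c1 - b / 2) \<le> c0 - a / 4"
    proof (rule cmod_le_of_Re_nonneg)
      fix e :: complex assume e: "cmod e = 1"
      show "0 \<le> c0 - a / 4 + Re (e * (c1 - b / 2))"
        using nonneg[OF e] unfolding sq[OF e] 2 by linarith
    qed
  qed
  then obtain S T where
      S: "is_ellipse_centered_at c S" "compact S" "\<And>w. cmod w = 1 \<Longrightarrow>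
        attains_support S w (Re (w * c) + sqrt (c0 + a / 4 + Re (w\<^sup>2 * (c1 + b / 2))))"
    and T: "is_ellipse_centered_at c T" "compact T" "\<And>w. cmod w = 1 \<Longrightarrow>
        attains_support T w (Re (w * c) + sqrt (c0 - a / 4 + Re (w\<^sup>2 * (c1 - b / 2))))"
    by (metis ellipse_with_support)
  let ?T = "convex hull (S \<union> T)"
  have cT: "compact ?T" using S(2) T(2) by (intro compact_convex_hull compact_Un)
  have both: "\<exists>s. attains_support W w s \<and> attains_support ?T w s" if w: "cmod w = 1" for w
  proof -
    have w2: "cmod (w\<^sup>2) = 1" using w by (simp add: norm_power)
    have "max (Re (w * c) + sqrt (c0 + Re (w\<^sup>2 * c1) + p (w\<^sup>2) / 4))
        (Re (w * c) + sqrt (c0 + Re (w\<^sup>2 * c1) - p (w\<^sup>2) / 4))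
      = Re (w * c) + sqrt (c0 + Re (w\<^sup>2 * c1) + \<bar>p (w\<^sup>2)\<bar> / 4)"
      by (cases "p (w\<^sup>2) \<ge> 0") (auto simp: max_def)
    then have "attains_support ?T w (Re (w * c) + sqrt (c0 + Re (w\<^sup>2 * c1) + \<bar>p (w\<^sup>2)\<bar> / 4))"
      using attains_support_convex_hull_Un[OF S(3)[OF w] T(3)[OF w]] unfolding 1 2 by simp
    then show ?thesis using supp[OF w] unfolding sq[OF w2] by blast
  qed
  have "W \<subseteq> ?T"
    by (rule subset_of_attains_support[OF compact_imp_closed[OF cT] convex_convex_hull both])
  moreover have "?T \<subseteq> W"
    using both by (intro subset_of_attains_support[OF compact_imp_closed[OF assms(1)] assms(2)]) blast
  ultimately have "W = ?T" by blast
  then show "is_hull_of_ellipses_centered_at c W"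
    unfolding is_hull_of_ellipses_centered_at_def using S(1) T(1)
    by (intro exI[of _ "{S, T}"]) auto
qed

section \<open>Norms and adjoints of complex vectors and matrices\<close>

text \<open>The Euclidean norm as a real number, phrased by \<open>L2_set\<close> to inherit its
  Cauchy-Schwarz inequality.\<close>

definition cvec_norm :: "complex vec \<Rightarrow> real" where
  "cvec_norm v = L2_set (\<lambda>i. cmod (v $ i)) {..<dim_vec v}"

lemma cvec_norm_nonneg [simp]: "0 \<le> cvec_norm v"
  by (simp add: cvec_norm_def L2_set_nonneg)

lemma cscalar_prod_self_cvec_norm: "v \<bullet>c v = complex_of_real ((cvec_norm v)\<^sup>2)"
  using cscalar_prod_self[OF carrier_vecI[OF refl], of v]
  by (simp add: cvec_norm_def L2_set_def sum_nonneg)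

lemma cscalar_prod_self_eq_1_iff: "v \<bullet>c v = 1 \<longleftrightarrow> cvec_norm v = 1"
proof -
  have "v \<bullet>c v = 1 \<longleftrightarrow> (cvec_norm v)\<^sup>2 = 1"
    unfolding cscalar_prod_self_cvec_norm of_real_eq_1_iff ..
  also have "\<dots> \<longleftrightarrow> cvec_norm v = 1"
    using power2_eq_iff_nonneg[of "cvec_norm v" 1] by simp
  finally show ?thesis .
qed

lemma cvec_norm_smult: "cvec_norm (k \<cdot>\<^sub>v v) = cmod k * cvec_norm v"
  unfolding cvec_norm_def L2_set_right_distrib[OF norm_ge_zero]
  by (auto intro!: L2_set_cong simp: norm_mult)

lemma Re_cscalar_prod_le:
  assumes "x \<in> carrier_vec n" "y \<in> carrier_vec n"
  shows "Re (x \<bullet>c y) \<le> cvec_norm x * cvec_norm y"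
proof -
  have "Re (x \<bullet>c y) \<le> cmod (\<Sum>i<n. x $ i * cnj (y $ i))"
    using assms complex_Re_le_cmod[of "x \<bullet>c y"] by (simp add: scalar_prod_def lessThan_atLeast0)
  also have "\<dots> \<le> (\<Sum>i<n. \<bar>cmod (x $ i)\<bar> * \<bar>cmod (y $ i)\<bar>)"
    by (rule sum_norm_le) (simp add: norm_mult)
  also have "\<dots> \<le> cvec_norm x * cvec_norm y"
    using L2_set_mult_ineq[of "\<lambda>i. cmod (x $ i)" "\<lambda>i. cmod (y $ i)" "{..<n}"] assms
    by (simp add: cvec_norm_def)
  finally show ?thesis .
qed

lemma mat_adjoint_carrier [simp]:
  "A \<in> carrier_mat m n \<Longrightarrow> mat_adjoint A \<in> carrier_mat n m"
  by (auto simp: mat_adjoint_def)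

lemma cscalar_prod_mat_adjoint:
  fixes A :: "complex mat"
  assumes A: "A \<in> carrier_mat m n" and x: "x \<in> carrier_vec m" and y: "y \<in> carrier_vec n"
  shows "(mat_adjoint A *\<^sub>v x) \<bullet>c y = x \<bullet>c (A *\<^sub>v y)"
proof -
  have "(mat_adjoint A *\<^sub>v x) \<bullet>c y = (\<Sum>j<n. (\<Sum>i<m. cnj (A $$ (i,j)) * x $ i) * cnj (y $ j))"
    using A x y by (auto simp: mat_adjoint_def scalar_prod_def lessThan_atLeast0 intro!: sum.cong)
  also have "\<dots> = (\<Sum>i<m. \<Sum>j<n. cnj (A $$ (i,j)) * x $ i * cnj (y $ j))"
    by (simp add: sum_distrib_right) (rule sum.swap)
  also have "\<dots> = x \<bullet>c (A *\<^sub>v y)"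
    using A x y
    by (auto simp: scalar_prod_def lessThan_atLeast0 sum_distrib_left mult_ac intro!: sum.cong)
  finally show ?thesis .
qed

lemma cscalar_prod_mult_mat_vec:
  fixes A :: "complex mat"
  assumes A: "A \<in> carrier_mat m n" and y: "y \<in> carrier_vec n" and x: "x \<in> carrier_vec m"
  shows "(A *\<^sub>v y) \<bullet>c x = y \<bullet>c (mat_adjoint A *\<^sub>v x)"
  using cscalar_prod_mat_adjoint[OF A x y]
    cscalar_prod_swap[of "mat_adjoint A *\<^sub>v x" n y] cscalar_prod_swap[of x m "A *\<^sub>v y"] assms
  by (metis mat_adjoint_carrier mult_mat_vec_carrier)

section \<open>Extrema of quadratic forms in two variables\<close>

text \<open>Cauchy-Schwarz for (r, m) against (X^2 - Y^2, 2 X Y), whose length is X^2 + Y^2. It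
  serves both for the 2x2 Hermitian form and for distributing the norm of a unit vector over its two
  blocks.\<close>

lemma polar_quadratic_le:
  fixes r m X Y :: real
  shows "r * (X\<^sup>2 - Y\<^sup>2) + 2 * m * X * Y \<le> sqrt (r\<^sup>2 + m\<^sup>2) * (X\<^sup>2 + Y\<^sup>2)"
proof -
  have "(r * (X\<^sup>2 - Y\<^sup>2) + 2 * m * X * Y)\<^sup>2 + (r * (2 * X * Y) - m * (X\<^sup>2 - Y\<^sup>2))\<^sup>2
      = (r\<^sup>2 + m\<^sup>2) * (X\<^sup>2 + Y\<^sup>2)\<^sup>2"
    by (simp add: power2_eq_square algebra_simps)
  then have "(r * (X\<^sup>2 - Y\<^sup>2) + 2 * m * X * Y)\<^sup>2 \<le> (r\<^sup>2 + m\<^sup>2) * (X\<^sup>2 + Y\<^sup>2)\<^sup>2"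
    using zero_le_power2[of "r * (2 * X * Y) - m * (X\<^sup>2 - Y\<^sup>2)"] by linarith
  then have "r * (X\<^sup>2 - Y\<^sup>2) + 2 * m * X * Y \<le> sqrt ((r\<^sup>2 + m\<^sup>2) * (X\<^sup>2 + Y\<^sup>2)\<^sup>2)"
    by (rule real_le_rsqrt)
  also have "\<dots> = sqrt (r\<^sup>2 + m\<^sup>2) * (X\<^sup>2 + Y\<^sup>2)"
    by (simp add: real_sqrt_mult)
  finally show ?thesis .
qed

lemma polar_quadratic_attained:
  fixes r m :: real
  assumes "0 \<le> m"
  obtains X Y where "0 \<le> X" "0 \<le> Y" "X\<^sup>2 + Y\<^sup>2 = 1"
    "r * (X\<^sup>2 - Y\<^sup>2) + 2 * m * X * Y = sqrt (r\<^sup>2 + m\<^sup>2)"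
proof (cases "r\<^sup>2 + m\<^sup>2 = 0")
  case True
  then have "r = 0" "m = 0" by (simp_all add: sum_power2_eq_zero_iff)
  then show thesis by (intro that[of 1 0]) simp_all
next
  case False
  define s where "s = sqrt (r\<^sup>2 + m\<^sup>2)"
  have s2: "s\<^sup>2 = r\<^sup>2 + m\<^sup>2" by (simp add: s_def)
  have s: "s > 0" using False by (simp add: s_def sum_power2_gt_zero_iff sum_power2_eq_zero_iff)
  have "\<bar>r\<bar> \<le> s" unfolding s_def by (rule real_le_rsqrt) simp
  then have r: "- s \<le> r" "r \<le> s" by linarith+
  \<comment> \<open>Half-angle formulas: \<open>X\<close> and \<open>Y\<close> are cosine and sine
    of half the angle with cosine r / s and sine m / s.\<close>
  define X where "X = sqrt ((1 + r / s) / 2)"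
  define Y where "Y = sqrt ((1 - r / s) / 2)"
  have nn: "0 \<le> (1 + r / s) / 2" "0 \<le> (1 - r / s) / 2" using r s by (simp_all add: field_simps)
  have X2: "X\<^sup>2 = (1 + r / s) / 2" and Y2: "Y\<^sup>2 = (1 - r / s) / 2"
    using nn by (simp_all add: X_def Y_def)
  have "((1 + r / s) / 2) * ((1 - r / s) / 2) = (m / (2 * s))\<^sup>2"
    using s s2 by (simp add: power2_eq_square field_simps)
  then have XY: "X * Y = m / (2 * s)"
    unfolding X_def Y_def real_sqrt_mult[symmetric] using s assms by simp
  have "r * (X\<^sup>2 - Y\<^sup>2) + 2 * m * X * Y = r * (r / s) + 2 * m * (X * Y)"
    unfolding X2 Y2 by (simp add: field_simps)
  also have "\<dots> = s\<^sup>2 / s" unfolding XY s2 by (simp add: power2_eq_square add_divide_distrib)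
  also have "\<dots> = s" using s by (simp add: power2_eq_square)
  finally have val: "r * (X\<^sup>2 - Y\<^sup>2) + 2 * m * X * Y = s" .
  have "X\<^sup>2 + Y\<^sup>2 = 1" unfolding X2 Y2 by (simp add: field_simps)
  moreover have "0 \<le> X" "0 \<le> Y" using nn by (simp_all add: X_def Y_def)
  ultimately show thesis using that[of X Y] val unfolding s_def by blast
qed

text \<open>The factor is the largest eigenvalue of the Hermitian matrix with diagonal
  \<open>P\<close>, \<open>Q\<close> and upper right entry \<open>N\<close>.\<close>

lemma hermitian_form2_le:
  fixes P Q :: real and N x1 x2 :: complex
  shows "P * (cmod x1)\<^sup>2 + Q * (cmod x2)\<^sup>2 + 2 * Re (N * x2 * cnj x1)
    \<le> ((P + Q) / 2 + sqrt (((P - Q) / 2)\<^sup>2 + (cmod N)\<^sup>2)) * ((cmod x1)\<^sup>2 + (cmod x2)\<^sup>2)"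
proof -
  have "Re (N * x2 * cnj x1) \<le> cmod N * cmod x1 * cmod x2"
    using complex_Re_le_cmod[of "N * x2 * cnj x1"] by (simp add: norm_mult mult_ac del: times_complex.sel)
  moreover have "P * (cmod x1)\<^sup>2 + Q * (cmod x2)\<^sup>2 =
      (P + Q) / 2 * ((cmod x1)\<^sup>2 + (cmod x2)\<^sup>2) + (P - Q) / 2 * ((cmod x1)\<^sup>2 - (cmod x2)\<^sup>2)"
    by (simp add: field_simps)
  ultimately show ?thesis
    using polar_quadratic_le[of "(P - Q) / 2" "cmod x1" "cmod x2" "cmod N"]
    unfolding distrib_right[of _ _ "(cmod x1)\<^sup>2 + (cmod x2)\<^sup>2"] by linarith
qed

lemma hermitian_form2_attained:
  fixes P Q :: real and N :: complex
  obtains x1 x2 where "(cmod x1)\<^sup>2 + (cmod x2)\<^sup>2 = 1"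
    "P * (cmod x1)\<^sup>2 + Q * (cmod x2)\<^sup>2 + 2 * Re (N * x2 * cnj x1)
      = (P + Q) / 2 + sqrt (((P - Q) / 2)\<^sup>2 + (cmod N)\<^sup>2)"
proof -
  obtain X Y where XY: "0 \<le> X" "0 \<le> Y" "X\<^sup>2 + Y\<^sup>2 = 1"
      "(P - Q) / 2 * (X\<^sup>2 - Y\<^sup>2) + 2 * cmod N * X * Y = sqrt (((P - Q) / 2)\<^sup>2 + (cmod N)\<^sup>2)"
    using polar_quadratic_attained[OF norm_ge_zero] by metis
  \<comment> \<open>This phase, given to \<open>x2\<close>, makes the cross term real and
    nonnegative, which reduces the form to the real quadratic one.\<close>
  obtain \<mu> where \<mu>: "cmod \<mu> = 1" "N * \<mu> = complex_of_real (cmod N)"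
  proof (cases "N = 0")
    case True
    then show thesis by (intro that[of 1]) simp_all
  next
    case False
    then have "N * (cnj N / cmod N) = complex_of_real (cmod N)"
      using complex_norm_square[of N] by (simp add: field_simps power2_eq_square)
    then show thesis using False by (intro that[of "cnj N / cmod N"]) (simp_all add: norm_divide)
  qed
  have "N * (\<mu> * Y) * cnj (complex_of_real X) = (N * \<mu>) * (Y * X)" by simp
  also have "\<dots> = complex_of_real (cmod N * X * Y)" unfolding \<mu>(2) by simp
  finally have re: "Re (N * (\<mu> * Y) * cnj (complex_of_real X)) = cmod N * X * Y"
    by (simp only: Re_complex_of_real)
  have nX: "(cmod (complex_of_real X))\<^sup>2 = X\<^sup>2" and nY: "(cmod (\<mu> * Y))\<^sup>2 = Y\<^sup>2"
    using \<mu>(1) by (simp_all add: norm_mult)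
  have "P * X\<^sup>2 + Q * Y\<^sup>2 = (P + Q) / 2 * (X\<^sup>2 + Y\<^sup>2) + (P - Q) / 2 * (X\<^sup>2 - Y\<^sup>2)"
    by (simp add: field_simps)
  then have "P * (cmod (complex_of_real X))\<^sup>2 + Q * (cmod (\<mu> * Y))\<^sup>2
      + 2 * Re (N * (\<mu> * Y) * cnj (complex_of_real X))
      = (P + Q) / 2 + sqrt (((P - Q) / 2)\<^sup>2 + (cmod N)\<^sup>2)"
    unfolding nX nY re XY(3) using XY(4) by linarith
  moreover have "(cmod (complex_of_real X))\<^sup>2 + (cmod (\<mu> * Y))\<^sup>2 = 1"
    unfolding nX nY by (rule XY(3))
  ultimately show thesis by (rule that[rotated])
qed

section \<open>Coordinates in an orthonormal basis of the plane\<close>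

text \<open>Cramer's rule; a vanishing determinant together with orthogonality would force
  \<open>u2\<close> to be zero.\<close>

lemma orthonormal_basis2_expand:
  assumes "orthonormal_basis2 u1 u2" "v \<in> carrier_vec 2"
  obtains x1 x2 where "v = x1 \<cdot>\<^sub>v u1 + x2 \<cdot>\<^sub>v u2"
proof -
  define a b c d where "a = u1 $ 0" and "b = u1 $ 1" and "c = u2 $ 0" and "d = u2 $ 1"
  note abcd = this
  have u: "u1 \<in> carrier_vec 2" "u2 \<in> carrier_vec 2" using assms(1) by (auto simp: orthonormal_basis2_def)
  have "a * cnj a + b * cnj b = 1" "c * cnj c + d * cnj d = 1" "a * cnj c + b * cnj d = 0"
    using assms(1) unfolding orthonormal_basis2_def abcd scalar_prod_def
    by (auto simp: numeral_2_eq_2)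
  note on = this
  have "a * d - b * c \<noteq> 0"
  proof
    assume "a * d - b * c = 0"
    then have D: "a * d = b * c" by simp
    have "cnj (a * cnj c + b * cnj d) = 0" using on(3) by simp
    then have E: "cnj a * c = - (cnj b * d)" by (simp add: add_eq_0_iff)
    have "c = (a * cnj a + b * cnj b) * c" using on(1) by simp
    also have "\<dots> = a * (cnj a * c) + cnj b * (b * c)" by (simp add: algebra_simps)
    also have "\<dots> = 0" unfolding E D[symmetric] by simp
    finally have c: "c = 0" .
    have "d = (a * cnj a + b * cnj b) * d" using on(1) by simp
    also have "\<dots> = cnj a * (a * d) + b * (cnj b * d)" by (simp add: algebra_simps)
    also have "\<dots> = 0"
    proof -
      have "a * d = 0" "cnj b * d = 0" using D E c by simp_all
      then show ?thesis by (simp only:) simp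
    qed
    finally show False using on(2) c by simp
  qed
  note D = this
  show thesis
  proof (rule that)
    show "v = ((v $ 0 * d - v $ 1 * c) / (a * d - b * c)) \<cdot>\<^sub>v u1
        + ((a * v $ 1 - b * v $ 0) / (a * d - b * c)) \<cdot>\<^sub>v u2"
    proof (rule eq_vecI)
      fix i assume "i < dim_vec (((v $ 0 * d - v $ 1 * c) / (a * d - b * c)) \<cdot>\<^sub>v u1
        + ((a * v $ 1 - b * v $ 0) / (a * d - b * c)) \<cdot>\<^sub>v u2)"
      then have "i < 2" using u by simp
      then consider "i = 0" | "i = 1" by linarith
      then show "v $ i = (((v $ 0 * d - v $ 1 * c) / (a * d - b * c)) \<cdot>\<^sub>v u1
        + ((a * v $ 1 - b * v $ 0) / (a * d - b * c)) \<cdot>\<^sub>v u2) $ i"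
      proof cases
        case 1
        have "v $ 0 = ((v $ 0 * d - v $ 1 * c) * a + (a * v $ 1 - b * v $ 0) * c) / (a * d - b * c)"
          using D by (simp add: eq_divide_eq algebra_simps)
        then show ?thesis using 1 u by (simp add: abcd add_divide_distrib)
      next
        case 2
        have "v $ 1 = ((v $ 0 * d - v $ 1 * c) * b + (a * v $ 1 - b * v $ 0) * d) / (a * d - b * c)"
          using D by (simp add: eq_divide_eq algebra_simps)
        then show ?thesis using 2 u by (simp add: abcd add_divide_distrib)
      qed
    qed (use assms(2) u in simp)
  qed
qed

lemma cvec_norm_add_smult_orthonormal:
  assumes "orthonormal_basis2 u1 u2"
  shows "(cvec_norm (x1 \<cdot>\<^sub>v u1 + x2 \<cdot>\<^sub>v u2))\<^sup>2 = (cmod x1)\<^sup>2 + (cmod x2)\<^sup>2"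
proof -
  have u: "u1 \<in> carrier_vec 2" "u2 \<in> carrier_vec 2" "u1 \<bullet>c u1 = 1" "u2 \<bullet>c u2 = 1" "u1 \<bullet>c u2 = 0"
    using assms by (auto simp: orthonormal_basis2_def)
  have u21: "u2 \<bullet>c u1 = 0" using cscalar_prod_swap[OF u(1,2)] u(5) by simp
  have "complex_of_real ((cvec_norm (x1 \<cdot>\<^sub>v u1 + x2 \<cdot>\<^sub>v u2))\<^sup>2) = complex_of_real ((cmod x1)\<^sup>2 + (cmod x2)\<^sup>2)"
    unfolding cscalar_prod_self_cvec_norm[symmetric] cscalar_prod_self_add_smult[OF u(1,2)] u u21
    by (simp add: complex_norm_square del: of_real_power)
  then show ?thesis unfolding of_real_eq_iff .
qed

lemma onb_entry_expand:
  assumes on: "orthonormal_basis2 u1 u2" and "X \<in> carrier_mat 2 2" and "v \<in> carrier_vec 2"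
  shows "X *\<^sub>v v = onb_entry X u1 v \<cdot>\<^sub>v u1 + onb_entry X u2 v \<cdot>\<^sub>v u2"
proof -
  have u: "u1 \<in> carrier_vec 2" "u2 \<in> carrier_vec 2" "u1 \<bullet>c u1 = 1" "u2 \<bullet>c u2 = 1" "u1 \<bullet>c u2 = 0"
    using on by (auto simp: orthonormal_basis2_def)
  have u21: "u2 \<bullet>c u1 = 0" using cscalar_prod_swap[OF u(1,2)] u(5) by simp
  obtain x1 x2 where x: "X *\<^sub>v v = x1 \<cdot>\<^sub>v u1 + x2 \<cdot>\<^sub>v u2"
    using orthonormal_basis2_expand[OF on] mult_mat_vec_carrier[OF assms(2,3)] by blast
  have "onb_entry X u1 v = x1" "onb_entry X u2 v = x2"
    unfolding onb_entry_def x cscalar_prod_add_smult_left[OF u(1,2,1)] cscalar_prod_add_smult_left[OF u(1,2,2)]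
    by (simp_all add: u u21)
  then show ?thesis using x by simp
qed

lemma scalar_mat_mult_vec:
  fixes v :: "'a :: comm_ring_1 vec"
  assumes "v \<in> carrier_vec n"
  shows "(k \<cdot>\<^sub>m 1\<^sub>m n) *\<^sub>v v = k \<cdot>\<^sub>v v"
  using assms by (intro eq_vecI) (auto simp: row_smult)

section \<open>The support function of the numerical range of the block matrix\<close>

context
  fixes m :: nat and C D :: "complex mat" and u1 u2 :: "complex vec"
  assumes C: "C \<in> carrier_mat m 2" and D: "D \<in> carrier_mat 2 m"
    and on: "orthonormal_basis2 u1 u2"
begin

lemma onb_vecs: "u1 \<in> carrier_vec 2" "u2 \<in> carrier_vec 2"
  using on by (auto simp: orthonormal_basis2_def)

lemma off_diagonal_carrier:
  assumes "v \<in> carrier_vec 2"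
  shows "w \<cdot>\<^sub>v (C *\<^sub>v v) + cnj w \<cdot>\<^sub>v (mat_adjoint D *\<^sub>v v) \<in> carrier_vec m"
  using mult_mat_vec_carrier[OF C assms] mult_mat_vec_carrier[OF mat_adjoint_carrier[OF D] assms] by simp

lemma quadratic_form_H:
  assumes v: "v \<in> carrier_vec 2"
  shows "((mat_adjoint C * C + D * mat_adjoint D) *\<^sub>v v) \<bullet>c v =
    (C *\<^sub>v v) \<bullet>c (C *\<^sub>v v) + (mat_adjoint D *\<^sub>v v) \<bullet>c (mat_adjoint D *\<^sub>v v)"
proof -
  note c = mult_mat_vec_carrier[OF C v] mult_mat_vec_carrier[OF mat_adjoint_carrier[OF D] v]
    mat_adjoint_carrier[OF C] mat_adjoint_carrier[OF D]
  have "(mat_adjoint C * C + D * mat_adjoint D) *\<^sub>v v = mat_adjoint C *\<^sub>v (C *\<^sub>v v) + D *\<^sub>v (mat_adjoint D *\<^sub>v v)"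
    unfolding add_mult_distrib_mat_vec[OF mult_carrier_mat[OF c(3) C] mult_carrier_mat[OF D c(4)] v]
      assoc_mult_mat_vec[OF c(3) C v] assoc_mult_mat_vec[OF D c(4) v] ..
  then show ?thesis
    unfolding cscalar_prod_mat_adjoint[OF C c(1) v, symmetric] cscalar_prod_mult_mat_vec[OF D c(2) v, symmetric]
    by (simp only: add_scalar_prod_distrib[OF mult_mat_vec_carrier[OF c(3) c(1)]
        mult_mat_vec_carrier[OF D c(2)] carrier_vec_conjugate[OF v]])
qed

lemma quadratic_form_Z:
  assumes v: "v \<in> carrier_vec 2"
  shows "((D * C) *\<^sub>v v) \<bullet>c v = (C *\<^sub>v v) \<bullet>c (mat_adjoint D *\<^sub>v v)"
  using cscalar_prod_mult_mat_vec[OF D mult_mat_vec_carrier[OF C v] v] C D v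
  by (simp add: assoc_mult_mat_vec[of _ 2 m _ 2])

text \<open>The squared terms combine to <H v, v>, and the cross term is <C v, D^H v> = <Z v, v>
  with factor w / cnj (cnj w)^-1 = w^2; this is the origin of e = w^2.\<close>

lemma cvec_norm_off_diagonal:
  assumes v: "v \<in> carrier_vec 2" and w: "cmod w = 1"
  shows "(cvec_norm (w \<cdot>\<^sub>v (C *\<^sub>v v) + cnj w \<cdot>\<^sub>v (mat_adjoint D *\<^sub>v v)))\<^sup>2 =
    Re (((mat_adjoint C * C + D * mat_adjoint D) *\<^sub>v v) \<bullet>c v) + 2 * Re (w\<^sup>2 * (((D * C) *\<^sub>v v) \<bullet>c v))"
proof -
  let ?x = "C *\<^sub>v v" and ?y = "mat_adjoint D *\<^sub>v v"
  note c = mult_mat_vec_carrier[OF C v] mult_mat_vec_carrier[OF mat_adjoint_carrier[OF D] v]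
  have ww: "w * cnj w = 1" using w by (simp add: complex_norm_square[symmetric])
  have "(w \<cdot>\<^sub>v ?x + cnj w \<cdot>\<^sub>v ?y) \<bullet>c (w \<cdot>\<^sub>v ?x + cnj w \<cdot>\<^sub>v ?y) =
      (w * cnj w) * (?x \<bullet>c ?x + ?y \<bullet>c ?y) + (w\<^sup>2 * (?x \<bullet>c ?y) + cnj (w\<^sup>2 * (?x \<bullet>c ?y)))"
    unfolding cscalar_prod_self_add_smult[OF c] cscalar_prod_swap[OF c]
    by (simp add: power2_eq_square algebra_simps)
  also have "\<dots> = ?x \<bullet>c ?x + ?y \<bullet>c ?y + complex_of_real (2 * Re (w\<^sup>2 * (?x \<bullet>c ?y)))"
    unfolding ww complex_add_cnj by simp
  finally have "complex_of_real ((cvec_norm (w \<cdot>\<^sub>v ?x + cnj w \<cdot>\<^sub>v ?y))\<^sup>2) =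
      ((mat_adjoint C * C + D * mat_adjoint D) *\<^sub>v v) \<bullet>c v
      + complex_of_real (2 * Re (w\<^sup>2 * (((D * C) *\<^sub>v v) \<bullet>c v)))"
    unfolding quadratic_form_H[OF v] quadratic_form_Z[OF v] cscalar_prod_self_cvec_norm[of "w \<cdot>\<^sub>v ?x + cnj w \<cdot>\<^sub>v ?y"] .
  from arg_cong[OF this, of Re] show ?thesis
    unfolding plus_complex.sel Re_complex_of_real .
qed

lemma block_quadratic_form:
  assumes y: "y \<in> carrier_vec m" and v: "v \<in> carrier_vec 2"
  shows "(four_block_mat (\<alpha> \<cdot>\<^sub>m 1\<^sub>m m) C D (\<beta> \<cdot>\<^sub>m 1\<^sub>m 2) *\<^sub>v (y @\<^sub>v v)) \<bullet>c (y @\<^sub>v v) =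
    \<alpha> * (y \<bullet>c y) + \<beta> * (v \<bullet>c v) + (C *\<^sub>v v) \<bullet>c y + (D *\<^sub>v y) \<bullet>c v"
proof -
  have conj: "conjugate (y @\<^sub>v v) = conjugate y @\<^sub>v conjugate v"
    by (rule eq_vecI) auto
  have "four_block_mat (\<alpha> \<cdot>\<^sub>m 1\<^sub>m m) C D (\<beta> \<cdot>\<^sub>m 1\<^sub>m 2) *\<^sub>v (y @\<^sub>v v) =
      (\<alpha> \<cdot>\<^sub>v y + C *\<^sub>v v) @\<^sub>v (D *\<^sub>v y + \<beta> \<cdot>\<^sub>v v)"
    using C D y v by (subst four_block_mat_mult_vec[of _ m m _ 2 _ 2]) (auto simp: scalar_mat_mult_vec)
  then show ?thesis
    using C D y v mult_mat_vec_carrier[OF C v] mult_mat_vec_carrier[OF D y] unfolding conj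
    by (simp add: scalar_prod_append[of _ m _ 2] add_scalar_prod_distrib[of _ m] add_scalar_prod_distrib[of _ 2])
qed

text \<open>Since the squared norms add up to 1, the diagonal part splits into the center (\<alpha>
  + \<beta>) / 2 and a multiple of their difference. The two off-diagonal terms merge by conjugating
  the one with \<open>D\<close>.\<close>

lemma Re_block_quadratic_form:
  assumes y: "y \<in> carrier_vec m" and v: "v \<in> carrier_vec 2"
    and nrm: "(cvec_norm y)\<^sup>2 + (cvec_norm v)\<^sup>2 = 1"
  shows "Re (w * ((four_block_mat (\<alpha> \<cdot>\<^sub>m 1\<^sub>m m) C D (\<beta> \<cdot>\<^sub>m 1\<^sub>m 2) *\<^sub>v (y @\<^sub>v v)) \<bullet>c (y @\<^sub>v v))) =
    Re (w * ((\<alpha> + \<beta>) / 2)) + Re (w * ((\<alpha> - \<beta>) / 2)) * ((cvec_norm y)\<^sup>2 - (cvec_norm v)\<^sup>2)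
    + Re ((w \<cdot>\<^sub>v (C *\<^sub>v v) + cnj w \<cdot>\<^sub>v (mat_adjoint D *\<^sub>v v)) \<bullet>c y)"
proof -
  note c = mult_mat_vec_carrier[OF C v] mult_mat_vec_carrier[OF mat_adjoint_carrier[OF D] v]
  define Y V where "Y = (cvec_norm y)\<^sup>2" and "V = (cvec_norm v)\<^sup>2"
  have YV: "\<alpha> * complex_of_real Y + \<beta> * complex_of_real V
      = (\<alpha> + \<beta>) / 2 * complex_of_real (Y + V) + (\<alpha> - \<beta>) / 2 * complex_of_real (Y - V)"
    by (simp add: field_simps)
  have "Y + V = 1" using nrm by (simp add: Y_def V_def)
  then have split: "\<alpha> * complex_of_real Y + \<beta> * complex_of_real V
      = (\<alpha> + \<beta>) / 2 + (\<alpha> - \<beta>) / 2 * complex_of_real (Y - V)"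
    unfolding YV by simp
  have 1: "Re (w * (\<alpha> * complex_of_real Y + \<beta> * complex_of_real V)) =
      Re (w * ((\<alpha> + \<beta>) / 2)) + Re (w * ((\<alpha> - \<beta>) / 2)) * (Y - V)"
  proof -
    have "w * (\<alpha> * complex_of_real Y + \<beta> * complex_of_real V)
      = w * ((\<alpha> + \<beta>) / 2) + (w * ((\<alpha> - \<beta>) / 2)) * complex_of_real (Y - V)"
      unfolding split
      by (simp only: distrib_left mult.assoc)
    then show ?thesis
      by (simp only: plus_complex.sel times_complex.sel(1)[of _ "complex_of_real (Y - V)"]
          Re_complex_of_real Im_complex_of_real mult_zero_right diff_zero)
  qed
  have "(D *\<^sub>v y) \<bullet>c v = cnj ((mat_adjoint D *\<^sub>v v) \<bullet>c y)"
    using cscalar_prod_mult_mat_vec[OF D y v] cscalar_prod_swap[OF c(2) y] by simp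
  then have "w * ((D *\<^sub>v y) \<bullet>c v) = cnj (cnj w * ((mat_adjoint D *\<^sub>v v) \<bullet>c y))" by simp
  then have "Re (w * ((D *\<^sub>v y) \<bullet>c v)) = Re (cnj w * ((mat_adjoint D *\<^sub>v v) \<bullet>c y))"
    by (simp only: cnj.sel(1))
  then show ?thesis
    unfolding block_quadratic_form[OF y v] cscalar_prod_add_smult_left[OF c y]
      cscalar_prod_self_cvec_norm Y_def[symmetric] V_def[symmetric]
    using 1 by (simp only: distrib_left plus_complex.sel)
qed

text \<open>The Hermitian form of H + e Z + (e Z)^H, e = w^2, in the coordinates of \<open>v\<close>
  with respect to \<open>u1\<close>, \<open>u2\<close>.\<close>

lemma cvec_norm_off_diagonal_onb:
  fixes h1 h2 :: complex
  defines "Z \<equiv> D * C"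
  defines "z11 \<equiv> onb_entry Z u1 u1" and "z12 \<equiv> onb_entry Z u1 u2"
    and "z21 \<equiv> onb_entry Z u2 u1" and "z22 \<equiv> onb_entry Z u2 u2"
  assumes H1: "(mat_adjoint C * C + D * mat_adjoint D) *\<^sub>v u1 = h1 \<cdot>\<^sub>v u1"
    and H2: "(mat_adjoint C * C + D * mat_adjoint D) *\<^sub>v u2 = h2 \<cdot>\<^sub>v u2"
    and w: "cmod w = 1"
    and v: "v = x1 \<cdot>\<^sub>v u1 + x2 \<cdot>\<^sub>v u2"
  shows "(cvec_norm (w \<cdot>\<^sub>v (C *\<^sub>v v) + cnj w \<cdot>\<^sub>v (mat_adjoint D *\<^sub>v v)))\<^sup>2 =
    (Re h1 + 2 * Re (w\<^sup>2 * z11)) * (cmod x1)\<^sup>2 + (Re h2 + 2 * Re (w\<^sup>2 * z22)) * (cmod x2)\<^sup>2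
    + 2 * Re ((w\<^sup>2 * z12 + cnj (w\<^sup>2 * z21)) * x2 * cnj x1)"
proof -
  have u: "u1 \<in> carrier_vec 2" "u2 \<in> carrier_vec 2" "u1 \<bullet>c u1 = 1" "u2 \<bullet>c u2 = 1" "u1 \<bullet>c u2 = 0"
    using on by (auto simp: orthonormal_basis2_def)
  have u21: "u2 \<bullet>c u1 = 0" using cscalar_prod_swap[OF u(1,2)] u(5) by simp
  have Z: "Z \<in> carrier_mat 2 2" using C D by (simp add: Z_def)
  have H: "mat_adjoint C * C + D * mat_adjoint D \<in> carrier_mat 2 2"
    using mult_carrier_mat[OF mat_adjoint_carrier[OF C] C] mult_carrier_mat[OF D mat_adjoint_carrier[OF D]] by simp
  have vc: "v \<in> carrier_vec 2" using u by (simp add: v)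
  have "((mat_adjoint C * C + D * mat_adjoint D) *\<^sub>v v) \<bullet>c v = h1 * (x1 * cnj x1) + h2 * (x2 * cnj x2)"
    unfolding v quadratic_form_add_smult[OF H u(1,2)] H1 H2 using u u21 by simp
  then have 1: "Re (((mat_adjoint C * C + D * mat_adjoint D) *\<^sub>v v) \<bullet>c v) = Re h1 * (cmod x1)\<^sup>2 + Re h2 * (cmod x2)\<^sup>2"
    unfolding complex_norm_square[symmetric] by simp
  have "w\<^sup>2 * ((Z *\<^sub>v v) \<bullet>c v) = w\<^sup>2 * z11 * (x1 * cnj x1) + w\<^sup>2 * z22 * (x2 * cnj x2)
      + (w\<^sup>2 * z12 * x2 * cnj x1 + cnj (cnj (w\<^sup>2 * z21) * x2 * cnj x1))"
    unfolding v quadratic_form_add_smult[OF Z u(1,2)] z11_def z12_def z21_def z22_def onb_entry_def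
    by (simp add: algebra_simps)
  then have "Re (w\<^sup>2 * ((Z *\<^sub>v v) \<bullet>c v)) = Re (w\<^sup>2 * z11 * complex_of_real ((cmod x1)\<^sup>2))
      + Re (w\<^sup>2 * z22 * complex_of_real ((cmod x2)\<^sup>2))
      + (Re (w\<^sup>2 * z12 * x2 * cnj x1) + Re (cnj (w\<^sup>2 * z21) * x2 * cnj x1))"
    unfolding complex_norm_square by (simp only: plus_complex.sel cnj.sel(1))
  moreover have "Re (u * complex_of_real s) = Re u * s" for u s by simp
  ultimately have "Re (w\<^sup>2 * ((Z *\<^sub>v v) \<bullet>c v)) = Re (w\<^sup>2 * z11) * (cmod x1)\<^sup>2 + Re (w\<^sup>2 * z22) * (cmod x2)\<^sup>2
      + Re ((w\<^sup>2 * z12 + cnj (w\<^sup>2 * z21)) * x2 * cnj x1)"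
    by (simp only: distrib_right plus_complex.sel)
  then show ?thesis
    unfolding cvec_norm_off_diagonal[OF vc w] 1 Z_def[symmetric] by (simp only: distrib_right distrib_left mult.assoc)
qed

text \<open>For a unit vector with blocks \<open>y\<close>, \<open>v\<close> of norms Y, V, the best
  \<open>y\<close> is parallel to \<open>M v\<close> and the best \<open>v\<close> is a top
  eigenvector of M^H M with eigenvalue \<open>L\<close>. This leaves r (Y^2 - V^2) + sqrt L Y V,
  whose maximum is sqrt (r^2 + L / 4).\<close>

proposition attains_support_numerical_range_block:
  fixes \<alpha> \<beta> h1 h2 :: complex
  defines "Z \<equiv> D * C"
  defines "z11 \<equiv> onb_entry Z u1 u1" and "z12 \<equiv> onb_entry Z u1 u2"
    and "z21 \<equiv> onb_entry Z u2 u1" and "z22 \<equiv> onb_entry Z u2 u2"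
  defines "q \<equiv> trig_discriminant ((Re h1 - Re h2) / 2) ((z11 - z22) / 2) z12 z21"
  defines "c0 \<equiv> (cmod ((\<alpha> - \<beta>) / 2))\<^sup>2 / 2 + (Re h1 + Re h2) / 8"
    and "c1 \<equiv> ((\<alpha> - \<beta>) / 2)\<^sup>2 / 2 + (z11 + z22) / 4"
  assumes H1: "(mat_adjoint C * C + D * mat_adjoint D) *\<^sub>v u1 = h1 \<cdot>\<^sub>v u1"
    and H2: "(mat_adjoint C * C + D * mat_adjoint D) *\<^sub>v u2 = h2 \<cdot>\<^sub>v u2"
    and m: "0 < m" and w: "cmod w = 1"
  shows "attains_support (numerical_range (four_block_mat (\<alpha> \<cdot>\<^sub>m 1\<^sub>m m) C D (\<beta> \<cdot>\<^sub>m 1\<^sub>m 2))) w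
      (Re (w * ((\<alpha> + \<beta>) / 2)) + sqrt (c0 + Re (w\<^sup>2 * c1) + sqrt (q (w\<^sup>2)) / 4))" (is "attains_support ?W w (_ + sqrt ?G)")
    and "0 \<le> c0 + Re (w\<^sup>2 * c1) - sqrt (q (w\<^sup>2)) / 4"
proof -
  define M where "M = (\<lambda>v. w \<cdot>\<^sub>v (C *\<^sub>v v) + cnj w \<cdot>\<^sub>v (mat_adjoint D *\<^sub>v v))"
  have Mc: "M v \<in> carrier_vec m" if "v \<in> carrier_vec 2" for v
    unfolding M_def by (rule off_diagonal_carrier[OF that])
  define P where "P = Re h1 + 2 * Re (w\<^sup>2 * z11)"
  define Q where "Q = Re h2 + 2 * Re (w\<^sup>2 * z22)"
  define N where "N = w\<^sup>2 * z12 + cnj (w\<^sup>2 * z21)"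
  have q: "q (w\<^sup>2) = ((P - Q) / 2)\<^sup>2 + (cmod N)\<^sup>2"
  proof -
    have "(Re h1 - Re h2) / 2 + 2 * Re (w\<^sup>2 * ((z11 - z22) / 2)) = (P - Q) / 2"
      by (simp add: P_def Q_def field_simps)
    then show ?thesis by (simp only: q_def trig_discriminant_def N_def)
  qed
  have K: "(cvec_norm (M (x1 \<cdot>\<^sub>v u1 + x2 \<cdot>\<^sub>v u2)))\<^sup>2 = P * (cmod x1)\<^sup>2 + Q * (cmod x2)\<^sup>2 + 2 * Re (N * x2 * cnj x1)" for x1 x2
    unfolding M_def P_def Q_def N_def z11_def z12_def z21_def z22_def Z_def
    by (rule cvec_norm_off_diagonal_onb[OF H1 H2 w refl])
  define L where "L = (P + Q) / 2 + sqrt (q (w\<^sup>2))"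
  have K_le: "(cvec_norm (M v))\<^sup>2 \<le> L * (cvec_norm v)\<^sup>2" if v: "v \<in> carrier_vec 2" for v
  proof -
    obtain x1 x2 where x: "v = x1 \<cdot>\<^sub>v u1 + x2 \<cdot>\<^sub>v u2" by (rule orthonormal_basis2_expand[OF on v])
    show ?thesis unfolding x K cvec_norm_add_smult_orthonormal[OF on] L_def q by (rule hermitian_form2_le)
  qed
  obtain v0 where v0: "v0 \<in> carrier_vec 2" "cvec_norm v0 = 1" "(cvec_norm (M v0))\<^sup>2 = L"
  proof -
    obtain x1 x2 where x: "(cmod x1)\<^sup>2 + (cmod x2)\<^sup>2 = 1"
        "P * (cmod x1)\<^sup>2 + Q * (cmod x2)\<^sup>2 + 2 * Re (N * x2 * cnj x1) = L"
      using hermitian_form2_attained[of P Q N] unfolding L_def q by metis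
    have "cvec_norm (x1 \<cdot>\<^sub>v u1 + x2 \<cdot>\<^sub>v u2) = 1"
      using cvec_norm_add_smult_orthonormal[OF on, of x1 x2] x(1)
        power2_eq_iff_nonneg[of "cvec_norm (x1 \<cdot>\<^sub>v u1 + x2 \<cdot>\<^sub>v u2)" 1] by simp
    then show thesis using x(2) K[of x1 x2] onb_vecs
      by (intro that[of "x1 \<cdot>\<^sub>v u1 + x2 \<cdot>\<^sub>v u2"]) simp_all
  qed
  then have L0: "0 \<le> L" by (metis zero_le_power2)
  define g where "g = (\<alpha> - \<beta>) / 2"
  define r where "r = Re (w * g)"
  \<comment> \<open>The double angle formula makes r^2, a priori a function of \<open>w\<close>, a
    degree 1 trigonometric polynomial in w^2.\<close>
  have r2: "r\<^sup>2 = (cmod g)\<^sup>2 / 2 + Re (w\<^sup>2 * (g\<^sup>2 / 2))"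
  proof -
    have "(2 * r)\<^sup>2 = 2 * (cmod g)\<^sup>2 + 2 * Re ((w * g)\<^sup>2)"
      unfolding r_def Re_add_cnj_sq using w by (simp add: norm_mult del: times_complex.sel)
    moreover have "Re (w\<^sup>2 * (g\<^sup>2 / 2)) = Re ((w * g)\<^sup>2) / 2"
      unfolding power_mult_distrib times_divide_eq_right by simp
    ultimately show ?thesis by (simp add: power_mult_distrib del: times_complex.sel)
  qed
  have "(P + Q) / 8 = (Re h1 + Re h2) / 8 + Re (w\<^sup>2 * ((z11 + z22) / 4))"
    by (simp add: P_def Q_def field_simps)
  then have PQ: "c0 + Re (w\<^sup>2 * c1) = r\<^sup>2 + (P + Q) / 8"
    unfolding c0_def c1_def r2 g_def distrib_left plus_complex.sel by linarith
  have G: "?G = r\<^sup>2 + (sqrt L / 2)\<^sup>2"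
    unfolding PQ using L0 by (simp add: L_def power_divide)
  show "0 \<le> c0 + Re (w\<^sup>2 * c1) - sqrt (q (w\<^sup>2)) / 4"
  proof -
    \<comment> \<open>Maximising the negated form shows that the smaller eigenvalue is a value of |M
      v|^2 as well, hence nonnegative.\<close>
    obtain x1 x2 where
        "(- P) * (cmod x1)\<^sup>2 + (- Q) * (cmod x2)\<^sup>2 + 2 * Re ((- N) * x2 * cnj x1)
          = (- P + - Q) / 2 + sqrt (((- P - - Q) / 2)\<^sup>2 + (cmod (- N))\<^sup>2)"
      using hermitian_form2_attained[of "- P" "- Q" "- N"] by metis
    moreover have "((- P - - Q) / 2)\<^sup>2 + (cmod (- N))\<^sup>2 = q (w\<^sup>2)"
      unfolding q by (simp add: power2_eq_square field_simps)
    ultimately have "(P + Q) / 2 - sqrt (q (w\<^sup>2)) = (cvec_norm (M (x1 \<cdot>\<^sub>v u1 + x2 \<cdot>\<^sub>v u2)))\<^sup>2"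
      unfolding K by (simp add: field_simps del: times_complex.sel)
    then have "0 \<le> (P + Q) / 2 - sqrt (q (w\<^sup>2))" by simp
    then show ?thesis unfolding PQ using zero_le_power2[of r] by linarith
  qed
  let ?A = "four_block_mat (\<alpha> \<cdot>\<^sub>m 1\<^sub>m m) C D (\<beta> \<cdot>\<^sub>m 1\<^sub>m 2)"
  have dA: "dim_row ?A = m + 2" by simp
  have unit: "(y @\<^sub>v v) \<bullet>c (y @\<^sub>v v) = complex_of_real ((cvec_norm y)\<^sup>2 + (cvec_norm v)\<^sup>2)"
    if "y \<in> carrier_vec m" "v \<in> carrier_vec 2" for y v
  proof -
    have "conjugate (y @\<^sub>v v) = conjugate y @\<^sub>v conjugate v" by (rule eq_vecI) auto
    then show ?thesis using that
      by (simp add: scalar_prod_append[of _ m _ 2] cscalar_prod_self_cvec_norm)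
  qed
  have form_eq: "Re (w * ((?A *\<^sub>v (y @\<^sub>v v)) \<bullet>c (y @\<^sub>v v))) =
      Re (w * ((\<alpha> + \<beta>) / 2)) + (r * ((cvec_norm y)\<^sup>2 - (cvec_norm v)\<^sup>2) + Re (M v \<bullet>c y))"
    if "y \<in> carrier_vec m" "v \<in> carrier_vec 2" "(cvec_norm y)\<^sup>2 + (cvec_norm v)\<^sup>2 = 1" for y v
    unfolding Re_block_quadratic_form[OF that] r_def g_def M_def by (simp only: add.assoc)
  show "attains_support ?W w (Re (w * ((\<alpha> + \<beta>) / 2)) + sqrt ?G)"
    unfolding attains_support_def
  proof
    show "\<forall>z\<in>?W. Re (w * z) \<le> Re (w * ((\<alpha> + \<beta>) / 2)) + sqrt ?G"
    proof
      fix z assume "z \<in> ?W"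
      then obtain x where x: "x \<in> carrier_vec (m + 2)" "x \<bullet>c x = 1" "z = (?A *\<^sub>v x) \<bullet>c x"
        unfolding numerical_range_def dA by blast
      define y v where "y = vec_first x m" and "v = vec_last x 2"
      have yv: "y \<in> carrier_vec m" "v \<in> carrier_vec 2" "x = y @\<^sub>v v"
        using x(1) by (simp_all add: y_def v_def)
      have n1: "(cvec_norm y)\<^sup>2 + (cvec_norm v)\<^sup>2 = 1"
        using x(2) unfolding yv(3) unit[OF yv(1,2)] of_real_eq_1_iff .
      have "cvec_norm (M v) \<le> sqrt L * cvec_norm v"
      proof (rule power2_le_imp_le)
        show "(cvec_norm (M v))\<^sup>2 \<le> (sqrt L * cvec_norm v)\<^sup>2"
          using K_le[OF yv(2)] L0 by (simp add: power_mult_distrib)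
      qed (use L0 in simp)
      then have "cvec_norm (M v) * cvec_norm y \<le> sqrt L * cvec_norm v * cvec_norm y"
        by (intro mult_right_mono) simp_all
      then have "Re (M v \<bullet>c y) \<le> 2 * (sqrt L / 2) * cvec_norm y * cvec_norm v"
        using Re_cscalar_prod_le[OF Mc[OF yv(2)] yv(1)] by (simp add: mult_ac)
      then have "r * ((cvec_norm y)\<^sup>2 - (cvec_norm v)\<^sup>2) + Re (M v \<bullet>c y) \<le> sqrt ?G"
        using polar_quadratic_le[of r "cvec_norm y" "cvec_norm v" "sqrt L / 2"] unfolding n1 G by linarith
      then show "Re (w * z) \<le> Re (w * ((\<alpha> + \<beta>) / 2)) + sqrt ?G"
        unfolding x(3) yv(3) form_eq[OF yv(1,2) n1] by simp
    qed
    \<comment> \<open>Normally the normalised \<open>M v0\<close>. If \<open>M v0\<close> = 0, any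
      unit vector works, and \<open>0 < m\<close> provides one.\<close>
    obtain y0 where y0: "y0 \<in> carrier_vec m" "cvec_norm y0 = 1" "Re (M v0 \<bullet>c y0) = sqrt L"
    proof (cases "L = 0")
      case True
      then have "M v0 \<bullet>c M v0 = 0" unfolding cscalar_prod_self_cvec_norm v0(3) by simp
      then have "M v0 = 0\<^sub>v m" using conjugate_square_eq_0_vec[OF Mc[OF v0(1)]] by simp
      moreover have "cvec_norm (unit_vec m 0) = 1"
        unfolding cscalar_prod_self_eq_1_iff[symmetric] using m by simp
      ultimately show thesis using True by (intro that[of "unit_vec m 0"]) simp_all
    next
      case False
      then have L: "L > 0" using L0 by simp
      have sL: "cvec_norm (M v0) = sqrt L" using v0(3) by (metis cvec_norm_nonneg real_sqrt_unique)
      let ?y = "complex_of_real (1 / sqrt L) \<cdot>\<^sub>v M v0"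
      have "cvec_norm ?y = 1" unfolding cvec_norm_smult sL norm_of_real using L by simp
      moreover have "M v0 \<bullet>c ?y = complex_of_real (1 / sqrt L) * (M v0 \<bullet>c M v0)"
        using Mc[OF v0(1)] by (simp add: conjugate_smult_vec)
      then have "M v0 \<bullet>c ?y = complex_of_real (1 / sqrt L * L)"
        unfolding cscalar_prod_self_cvec_norm v0(3) by simp
      then have "Re (M v0 \<bullet>c ?y) = sqrt L"
        using L by (simp only: Re_complex_of_real) (simp add: real_div_sqrt)
      ultimately show thesis using Mc[OF v0(1)] by (intro that[of ?y]) simp_all
    qed
    \<comment> \<open>The optimal distribution of the norm between the directions \<open>y0\<close>
      and \<open>v0\<close>.\<close>
    obtain Y V where YV: "0 \<le> Y" "0 \<le> V" "Y\<^sup>2 + V\<^sup>2 = 1"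
        "r * (Y\<^sup>2 - V\<^sup>2) + 2 * (sqrt L / 2) * Y * V = sqrt (r\<^sup>2 + (sqrt L / 2)\<^sup>2)"
      using polar_quadratic_attained[of "sqrt L / 2" r] L0 by auto
    let ?y = "complex_of_real Y \<cdot>\<^sub>v y0" and ?v = "complex_of_real V \<cdot>\<^sub>v v0"
    have c: "?y \<in> carrier_vec m" "?v \<in> carrier_vec 2" using y0 v0 by simp_all
    have n: "cvec_norm ?y = Y" "cvec_norm ?v = V"
      unfolding cvec_norm_smult y0(2) v0(2) norm_of_real using YV by simp_all
    have n1: "(cvec_norm ?y)\<^sup>2 + (cvec_norm ?v)\<^sup>2 = 1" unfolding n by (rule YV(3))
    note Cv = mult_mat_vec_carrier[OF C v0(1)] and Dv = mult_mat_vec_carrier[OF mat_adjoint_carrier[OF D] v0(1)]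
    have "M ?v \<bullet>c ?y = complex_of_real (V * Y) * (M v0 \<bullet>c y0)"
      unfolding M_def mult_mat_vec[OF C v0(1)] mult_mat_vec[OF mat_adjoint_carrier[OF D] v0(1)]
      using Cv Dv y0(1)
      by (simp add: conjugate_smult_vec add_scalar_prod_distrib[of _ m] algebra_simps)
    then have "Re (M ?v \<bullet>c ?y) = V * Y * sqrt L"
      using y0(3) by simp
    then have "r * ((cvec_norm ?y)\<^sup>2 - (cvec_norm ?v)\<^sup>2) + Re (M ?v \<bullet>c ?y) = sqrt ?G"
      unfolding G n YV(4)[symmetric] by simp
    then have "Re (w * ((?A *\<^sub>v (?y @\<^sub>v ?v)) \<bullet>c (?y @\<^sub>v ?v))) = Re (w * ((\<alpha> + \<beta>) / 2)) + sqrt ?G"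
      unfolding form_eq[OF c n1] by simp
    moreover have "(?A *\<^sub>v (?y @\<^sub>v ?v)) \<bullet>c (?y @\<^sub>v ?v) \<in> ?W"
      unfolding numerical_range_def dA
      using unit[OF c] append_carrier_vec[OF c] unfolding n1 of_real_1 by blast
    ultimately show "\<exists>z\<in>?W. Re (w * z) = Re (w * ((\<alpha> + \<beta>) / 2)) + sqrt ?G" by blast
  qed
qed

end

section \<open>Matrix entries and characteristic polynomial in an orthonormal basis\<close>

lemma onb_entry_mult:
  assumes on: "orthonormal_basis2 u1 u2" and X: "X \<in> carrier_mat 2 2" and Y: "Y \<in> carrier_mat 2 2"
    and a: "a \<in> carrier_vec 2" and b: "b \<in> carrier_vec 2"
  shows "onb_entry (X * Y) a b = onb_entry X a u1 * onb_entry Y u1 b + onb_entry X a u2 * onb_entry Y u2 b"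
proof -
  have u: "u1 \<in> carrier_vec 2" "u2 \<in> carrier_vec 2"
    using on by (auto simp: orthonormal_basis2_def)
  note c = mult_mat_vec_carrier[OF X u(1)] mult_mat_vec_carrier[OF X u(2)]
  have "(X * Y) *\<^sub>v b = onb_entry Y u1 b \<cdot>\<^sub>v (X *\<^sub>v u1) + onb_entry Y u2 b \<cdot>\<^sub>v (X *\<^sub>v u2)"
    unfolding assoc_mult_mat_vec[OF X Y b] onb_entry_expand[OF on Y b] mult_mat_vec_add_smult[OF X u] ..
  then show ?thesis
    unfolding onb_entry_def[of "X * Y"] onb_entry_def[of X]
    by (simp only: cscalar_prod_add_smult_left[OF c a]) (simp only: mult.commute)
qed

lemma onb_entry_mat_adjoint:
  assumes X: "X \<in> carrier_mat n n" and a: "a \<in> carrier_vec n" and b: "b \<in> carrier_vec n"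
  shows "onb_entry (mat_adjoint X) a b = cnj (onb_entry X b a)"
  unfolding onb_entry_def cscalar_prod_mat_adjoint[OF X b a]
  by (rule cscalar_prod_swap[OF mult_mat_vec_carrier[OF X a] b])

lemma mat_eq_iff_onb_entry:
  assumes on: "orthonormal_basis2 u1 u2" and X: "X \<in> carrier_mat 2 2" and Y: "Y \<in> carrier_mat 2 2"
  shows "X = Y \<longleftrightarrow> onb_entry X u1 u1 = onb_entry Y u1 u1 \<and> onb_entry X u1 u2 = onb_entry Y u1 u2
    \<and> onb_entry X u2 u1 = onb_entry Y u2 u1 \<and> onb_entry X u2 u2 = onb_entry Y u2 u2" (is "_ \<longleftrightarrow> ?R")
proof
  assume R: ?R
  have u: "u1 \<in> carrier_vec 2" "u2 \<in> carrier_vec 2"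
    using on by (auto simp: orthonormal_basis2_def)
  have "X *\<^sub>v u1 = Y *\<^sub>v u1" "X *\<^sub>v u2 = Y *\<^sub>v u2"
    using R onb_entry_expand[OF on X] onb_entry_expand[OF on Y] u by simp_all
  then have XY: "X *\<^sub>v v = Y *\<^sub>v v" if "v \<in> carrier_vec 2" for v
    using orthonormal_basis2_expand[OF on that] mult_mat_vec_add_smult[OF X u] mult_mat_vec_add_smult[OF Y u]
    by metis
  show "X = Y"
  proof (rule eq_matI)
    fix i j assume "i < dim_row Y" "j < dim_col Y"
    then have ij: "i < 2" "j < 2" using Y by simp_all
    have "(X *\<^sub>v unit_vec 2 j) $ i = (Y *\<^sub>v unit_vec 2 j) $ i" using XY[of "unit_vec 2 j"] by simp
    then show "X $$ (i, j) = Y $$ (i, j)" using X Y ij by simp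
  qed (use X Y in simp_all)
qed simp

lemma det_mat_2:
  fixes A :: "'a :: comm_ring_1 mat"
  assumes "A \<in> carrier_mat 2 2"
  shows "det A = A $$ (0,0) * A $$ (1,1) - A $$ (0,1) * A $$ (1,0)"
proof -
  have 1: "det (mat_delete A 0 j) = mat_delete A 0 j $$ (0,0)" for j
    using assms by (intro det_single) (auto simp: mat_delete_def)
  have "det A = (\<Sum>j<2. A $$ (0,j) * cofactor A 0 j)"
    by (rule laplace_expansion_row[OF assms]) simp
  then show ?thesis
    using assms unfolding cofactor_def 1 by (simp add: numeral_2_eq_2 mat_delete_def)
qed

lemma char_poly_mat_2:
  fixes A :: "complex mat"
  assumes "A \<in> carrier_mat 2 2"
  shows "char_poly A = [:A $$ (0,0) * A $$ (1,1) - A $$ (0,1) * A $$ (1,0), - (A $$ (0,0) + A $$ (1,1)), 1:]"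
  using assms unfolding char_poly_def det_mat_2[OF char_poly_matrix_closed[OF assms]]
  by (simp add: char_poly_matrix_def)

text \<open>The entries are those of V Z U, where U has columns \<open>u1\<close>, \<open>u2\<close>
  and V is its adjoint; orthonormality makes V the inverse of U, and similarity preserves the
  characteristic polynomial.\<close>

lemma char_poly_onb_entry:
  assumes on: "orthonormal_basis2 u1 u2" and Z: "Z \<in> carrier_mat 2 2"
  shows "char_poly Z = [:onb_entry Z u1 u1 * onb_entry Z u2 u2 - onb_entry Z u1 u2 * onb_entry Z u2 u1,
    - (onb_entry Z u1 u1 + onb_entry Z u2 u2), 1:]"
proof -
  have u: "u1 \<in> carrier_vec 2" "u2 \<in> carrier_vec 2" "u1 \<bullet>c u1 = 1" "u2 \<bullet>c u2 = 1" "u1 \<bullet>c u2 = 0"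
    using on by (auto simp: orthonormal_basis2_def)
  have u21: "u2 \<bullet>c u1 = 0" using cscalar_prod_swap[OF u(1,2)] u(5) by simp
  define us where "us = [u1, u2]"
  define U where "U = mat_of_cols 2 us"
  define V where "V = mat_of_rows 2 (map conjugate us)"
  have us: "length us = 2" "\<And>i. i < 2 \<Longrightarrow> us ! i \<in> carrier_vec 2"
    using u by (auto simp: us_def nth_Cons split: nat.split)
  have U: "U \<in> carrier_mat 2 2" and V: "V \<in> carrier_mat 2 2" by (auto simp: U_def V_def us_def)
  have col: "col U j = us ! j" if "j < 2" for j
    unfolding U_def using us that by (intro col_mat_of_cols) auto
  have row: "row V i = conjugate (us ! i)" if "i < 2" for i
    unfolding V_def using us that by (subst mat_of_rows_row) auto
  have VU: "V * U = 1\<^sub>m 2"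
  proof (rule eq_matI)
    fix i j assume "i < dim_row (1\<^sub>m 2 :: complex mat)" "j < dim_col (1\<^sub>m 2 :: complex mat)"
    then have ij: "i < 2" "j < 2" by simp_all
    have "(V * U) $$ (i, j) = us ! j \<bullet>c us ! i"
      using U V ij us conjugate_vec_sprod_comm[of "us ! j" 2 "us ! i"] by (simp add: row col)
    also have "\<dots> = (1\<^sub>m 2) $$ (i, j)"
      using ij u u21 by (auto simp: us_def less_2_cases_iff)
    finally show "(V * U) $$ (i, j) = 1\<^sub>m 2 $$ (i, j)" .
  qed (use U V in auto)
  have UV: "U * V = 1\<^sub>m 2" by (rule mat_mult_left_right_inverse[OF V U VU])
  define W where "W = V * Z * U"
  have W: "W \<in> carrier_mat 2 2" using U V Z by (simp add: W_def)
  have ent: "W $$ (i, j) = onb_entry Z (us ! i) (us ! j)" if ij: "i < 2" "j < 2" for i j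
  proof -
    have "W = V * (Z * U)" unfolding W_def by (rule assoc_mult_mat[OF V Z U])
    then have "W $$ (i, j) = conjugate (us ! i) \<bullet> (Z *\<^sub>v (us ! j))"
      using U V Z ij by (simp add: row col col_mult2[OF Z U])
    also have "\<dots> = onb_entry Z (us ! i) (us ! j)"
      using conjugate_vec_sprod_comm[of "Z *\<^sub>v (us ! j)" 2 "us ! i"] us ij Z by (simp add: onb_entry_def)
    finally show ?thesis .
  qed
  have "similar_mat_wit W Z V U" using similar_mat_witI[OF VU UV W_def W Z V U] .
  then have "char_poly W = char_poly Z"
    by (intro char_poly_similar) (auto simp: similar_mat_def)
  then show ?thesis
    using char_poly_mat_2[OF W] by (simp add: ent us_def)
qed

section \<open>Normality, commutation and shared eigenvectors in terms of entries\<close>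

context
  fixes H Z :: "complex mat" and h1 h2 :: complex and u1 u2 :: "complex vec"
  assumes on: "orthonormal_basis2 u1 u2" and H: "H \<in> carrier_mat 2 2" and Z: "Z \<in> carrier_mat 2 2"
    and H1: "H *\<^sub>v u1 = h1 \<cdot>\<^sub>v u1" and H2: "H *\<^sub>v u2 = h2 \<cdot>\<^sub>v u2"
begin

lemma basis_simps:
  "u1 \<in> carrier_vec 2" "u2 \<in> carrier_vec 2" "u1 \<bullet>c u1 = 1" "u2 \<bullet>c u2 = 1" "u1 \<bullet>c u2 = 0" "u2 \<bullet>c u1 = 0"
proof -
  show u: "u1 \<in> carrier_vec 2" "u2 \<in> carrier_vec 2" "u1 \<bullet>c u1 = 1" "u2 \<bullet>c u2 = 1" "u1 \<bullet>c u2 = 0"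
    using on by (auto simp: orthonormal_basis2_def)
  show "u2 \<bullet>c u1 = 0" using cscalar_prod_swap[OF u(1,2)] u(5) by simp
qed

lemma onb_entry_eigenbasis:
  "onb_entry H u1 u1 = h1" "onb_entry H u1 u2 = 0" "onb_entry H u2 u1 = 0" "onb_entry H u2 u2 = h2"
  using basis_simps by (simp_all add: onb_entry_def H1 H2)

text \<open>Of the four entry equations, both diagonal ones say |z12| = |z21|, and the two
  off-diagonal ones are conjugate to each other.\<close>

lemma normal_matrix_iff_onb_entry:
  "normal_matrix Z \<longleftrightarrow> cmod (onb_entry Z u1 u2) = cmod (onb_entry Z u2 u1) \<and>
     (onb_entry Z u1 u1 - onb_entry Z u2 u2) * cnj (onb_entry Z u2 u1) =
     cnj (onb_entry Z u1 u1 - onb_entry Z u2 u2) * onb_entry Z u1 u2"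
proof -
  note u = basis_simps
  define a b c d where "a = onb_entry Z u1 u1" and "b = onb_entry Z u1 u2"
    and "c = onb_entry Z u2 u1" and "d = onb_entry Z u2 u2"
  note Z' = mat_adjoint_carrier[OF Z]
  have bc: "b * cnj b = c * cnj c \<longleftrightarrow> cmod b = cmod c"
    unfolding complex_norm_square[symmetric] of_real_eq_iff by (simp add: power2_eq_iff_nonneg)
  have "normal_matrix Z \<longleftrightarrow>
      a * cnj a + b * cnj b = cnj a * a + cnj c * c \<and> a * cnj c + b * cnj d = cnj a * b + cnj c * d \<and>
      c * cnj a + d * cnj b = cnj b * a + cnj d * c \<and> c * cnj c + d * cnj d = cnj b * b + cnj d * d"
    unfolding normal_matrix_def mat_eq_iff_onb_entry[OF on mult_carrier_mat[OF Z Z'] mult_carrier_mat[OF Z' Z]]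
      onb_entry_mult[OF on Z Z' u(1) u(1)] onb_entry_mult[OF on Z Z' u(1) u(2)]
      onb_entry_mult[OF on Z Z' u(2) u(1)] onb_entry_mult[OF on Z Z' u(2) u(2)]
      onb_entry_mult[OF on Z' Z u(1) u(1)] onb_entry_mult[OF on Z' Z u(1) u(2)]
      onb_entry_mult[OF on Z' Z u(2) u(1)] onb_entry_mult[OF on Z' Z u(2) u(2)]
      onb_entry_mat_adjoint[OF Z u(1) u(1)] onb_entry_mat_adjoint[OF Z u(1) u(2)]
      onb_entry_mat_adjoint[OF Z u(2) u(1)] onb_entry_mat_adjoint[OF Z u(2) u(2)]
      a_def b_def c_def d_def ..
  also have "\<dots> \<longleftrightarrow> b * cnj b = c * cnj c \<and> (a - d) * cnj c = cnj (a - d) * b"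
  proof -
    have "a * cnj c + b * cnj d = cnj a * b + cnj c * d \<longleftrightarrow> (a - d) * cnj c = cnj (a - d) * b"
      by (auto simp: algebra_simps)
    moreover have "c * cnj a + d * cnj b = cnj b * a + cnj d * c \<longleftrightarrow>
        cnj (a * cnj c + b * cnj d) = cnj (cnj a * b + cnj c * d)"
      by (simp add: algebra_simps)
    moreover have "a * cnj a + b * cnj b = cnj a * a + cnj c * c \<longleftrightarrow> b * cnj b = c * cnj c"
      "c * cnj c + d * cnj d = cnj b * b + cnj d * d \<longleftrightarrow> b * cnj b = c * cnj c"
      by (auto simp: algebra_simps)
    ultimately show ?thesis unfolding complex_cnj_cancel_iff by blast
  qed
  finally show ?thesis unfolding bc unfolding a_def b_def c_def d_def .
qed

lemma commute_iff_onb_entry: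
  "Z * H = H * Z \<longleftrightarrow> (h1 - h2) * onb_entry Z u1 u2 = 0 \<and> (h1 - h2) * onb_entry Z u2 u1 = 0"
proof -
  note u = basis_simps
  show ?thesis
    unfolding mat_eq_iff_onb_entry[OF on mult_carrier_mat[OF Z H] mult_carrier_mat[OF H Z]]
      onb_entry_mult[OF on Z H u(1) u(1)] onb_entry_mult[OF on Z H u(1) u(2)]
      onb_entry_mult[OF on Z H u(2) u(1)] onb_entry_mult[OF on Z H u(2) u(2)]
      onb_entry_mult[OF on H Z u(1) u(1)] onb_entry_mult[OF on H Z u(1) u(2)]
      onb_entry_mult[OF on H Z u(2) u(1)] onb_entry_mult[OF on H Z u(2) u(2)]
      onb_entry_eigenbasis
    by (auto simp: algebra_simps)
qed

lemma eigenvector_combination: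
  assumes X: "X \<in> carrier_mat 2 2"
    and e: "eigenvector X (x1 \<cdot>\<^sub>v u1 + x2 \<cdot>\<^sub>v u2) k"
  shows "x1 * onb_entry X u1 u1 + x2 * onb_entry X u1 u2 = k * x1"
    "x1 * onb_entry X u2 u1 + x2 * onb_entry X u2 u2 = k * x2"
proof -
  note u = basis_simps
  note c = mult_mat_vec_carrier[OF X u(1)] mult_mat_vec_carrier[OF X u(2)]
  have "X *\<^sub>v (x1 \<cdot>\<^sub>v u1 + x2 \<cdot>\<^sub>v u2) = k \<cdot>\<^sub>v (x1 \<cdot>\<^sub>v u1 + x2 \<cdot>\<^sub>v u2)"
    using e by (simp add: eigenvector_def)
  also have "\<dots> = (k * x1) \<cdot>\<^sub>v u1 + (k * x2) \<cdot>\<^sub>v u2"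
    using u by (simp add: smult_add_distrib_vec[of _ 2] smult_smult_assoc)
  finally have "x1 \<cdot>\<^sub>v (X *\<^sub>v u1) + x2 \<cdot>\<^sub>v (X *\<^sub>v u2) = (k * x1) \<cdot>\<^sub>v u1 + (k * x2) \<cdot>\<^sub>v u2"
    unfolding mult_mat_vec_add_smult[OF X u(1,2)] .
  then have "(x1 \<cdot>\<^sub>v (X *\<^sub>v u1) + x2 \<cdot>\<^sub>v (X *\<^sub>v u2)) \<bullet>c z = ((k * x1) \<cdot>\<^sub>v u1 + (k * x2) \<cdot>\<^sub>v u2) \<bullet>c z" for z
    by simp
  from this[of u1] this[of u2]
  show "x1 * onb_entry X u1 u1 + x2 * onb_entry X u1 u2 = k * x1"
    "x1 * onb_entry X u2 u1 + x2 * onb_entry X u2 u2 = k * x2"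
    unfolding cscalar_prod_add_smult_left[OF c u(1)] cscalar_prod_add_smult_left[OF c u(2)]
      cscalar_prod_add_smult_left[OF u(1,2) u(1)] cscalar_prod_add_smult_left[OF u(1,2) u(2)] u onb_entry_def
    by simp_all
qed

text \<open>If h1 and h2 differ, every eigenvector of \<open>H\<close> is a multiple of
  \<open>u1\<close> or \<open>u2\<close>, and these are eigenvectors of \<open>Z\<close> exactly
  when z21 = 0 or z12 = 0. If they agree, \<open>H\<close> is scalar and any eigenvector of
  \<open>Z\<close> is shared; the assumed eigenvalue supplies one.\<close>

lemma shared_eigenvector_iff_onb_entry:
  assumes "eigenvalue Z z"
  shows "(\<exists>v k l. eigenvector Z v k \<and> eigenvector H v l) \<longleftrightarrow>
    h1 = h2 \<or> onb_entry Z u1 u2 = 0 \<or> onb_entry Z u2 u1 = 0"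
proof
  note u = basis_simps
  assume "\<exists>v k l. eigenvector Z v k \<and> eigenvector H v l"
  then obtain v k l where v: "eigenvector Z v k" "eigenvector H v l" by blast
  have vc: "v \<in> carrier_vec 2" "v \<noteq> 0\<^sub>v 2" using v(1) Z by (auto simp: eigenvector_def)
  obtain x1 x2 where x: "v = x1 \<cdot>\<^sub>v u1 + x2 \<cdot>\<^sub>v u2" by (rule orthonormal_basis2_expand[OF on vc(1)])
  have nz: "x1 \<noteq> 0 \<or> x2 \<noteq> 0"
  proof (rule ccontr)
    assume "\<not> ?thesis"
    then have "v = 0\<^sub>v 2" using u unfolding x by (intro eq_vecI) auto
    then show False using vc by simp
  qed
  have "x1 * h1 = l * x1" "x2 * h2 = l * x2"
    using eigenvector_combination[OF H v(2)[unfolded x]] unfolding onb_entry_eigenbasis by simp_all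
  then have "h1 = h2 \<or> x1 = 0 \<or> x2 = 0" by auto
  then show "h1 = h2 \<or> onb_entry Z u1 u2 = 0 \<or> onb_entry Z u2 u1 = 0"
    using eigenvector_combination[OF Z v(1)[unfolded x]] nz by auto
next
  note u = basis_simps
  have nz: "u1 \<noteq> 0\<^sub>v 2" "u2 \<noteq> 0\<^sub>v 2" using u by auto
  have zero: "0 \<cdot>\<^sub>v u1 = 0\<^sub>v 2" "0 \<cdot>\<^sub>v u2 = 0\<^sub>v 2" using u by (auto intro!: eq_vecI)
  assume "h1 = h2 \<or> onb_entry Z u1 u2 = 0 \<or> onb_entry Z u2 u1 = 0"
  then consider "h1 = h2" | "onb_entry Z u1 u2 = 0" | "onb_entry Z u2 u1 = 0" by blast
  then show "\<exists>v k l. eigenvector Z v k \<and> eigenvector H v l"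
  proof cases
    case 1
    from assms obtain v where v: "eigenvector Z v z" by (auto simp: eigenvalue_def)
    then have vc: "v \<in> carrier_vec 2" "v \<noteq> 0\<^sub>v 2" using Z by (auto simp: eigenvector_def)
    obtain x1 x2 where x: "v = x1 \<cdot>\<^sub>v u1 + x2 \<cdot>\<^sub>v u2" by (rule orthonormal_basis2_expand[OF on vc(1)])
    have "H *\<^sub>v v = h1 \<cdot>\<^sub>v v"
      unfolding x mult_mat_vec_add_smult[OF H u(1,2)] H1 H2 1 using u
      by (simp add: smult_add_distrib_vec[of _ 2] smult_smult_assoc mult.commute)
    then have "eigenvector H v h1" using vc H by (simp add: eigenvector_def)
    then show ?thesis using v by blast
  next
    case 2
    then have "Z *\<^sub>v u2 = onb_entry Z u2 u2 \<cdot>\<^sub>v u2"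
      using onb_entry_expand[OF on Z u(2)] u by (simp add: zero)
    then have "eigenvector Z u2 (onb_entry Z u2 u2)" "eigenvector H u2 h2"
      using u nz H Z H2 by (simp_all add: eigenvector_def)
    then show ?thesis by blast
  next
    case 3
    then have "Z *\<^sub>v u1 = onb_entry Z u1 u1 \<cdot>\<^sub>v u1"
      using onb_entry_expand[OF on Z u(1)] u by (simp add: zero)
    then have "eigenvector Z u1 (onb_entry Z u1 u1)" "eigenvector H u1 h1"
      using u nz H Z H1 by (simp_all add: eigenvector_def)
    then show ?thesis by blast
  qed
qed

end

section \<open>The characterization\<close>

text \<open>Both sides are trace^2 - 4 det, computed from the eigenvalues and from the
  entries.\<close>

lemma eigenvalue_difference_sq:
  fixes z1 z2 :: complex
  assumes on: "orthonormal_basis2 u1 u2" and Z: "Z \<in> carrier_mat 2 2"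
    and cp: "char_poly Z = [:- z1, 1:] * [:- z2, 1:]"
  shows "(z1 - z2)\<^sup>2 = 4 * (((onb_entry Z u1 u1 - onb_entry Z u2 u2) / 2)\<^sup>2
    + onb_entry Z u1 u2 * onb_entry Z u2 u1)"
proof -
  have "onb_entry Z u1 u1 * onb_entry Z u2 u2 - onb_entry Z u1 u2 * onb_entry Z u2 u1 = z1 * z2"
    "onb_entry Z u1 u1 + onb_entry Z u2 u2 = z1 + z2"
    using char_poly_onb_entry[OF on Z] unfolding cp by (auto simp: algebra_simps)
  then have "(z1 + z2)\<^sup>2 - 4 * (z1 * z2) = (onb_entry Z u1 u1 + onb_entry Z u2 u2)\<^sup>2
      - 4 * (onb_entry Z u1 u1 * onb_entry Z u2 u2 - onb_entry Z u1 u2 * onb_entry Z u2 u1)" by simp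
  then show ?thesis by (simp add: power_divide) (simp add: power2_eq_square algebra_simps)
qed

theorem theorem4:
  fixes n :: nat
    and \<alpha> \<beta> h1 h2 z1 z2 z12 z21 :: complex
    and A C D H Z :: "complex mat"
    and u1 u2 :: "complex vec"
  assumes "n \<ge> 4"
    and "C \<in> carrier_mat (n - 2) 2"
    and "D \<in> carrier_mat 2 (n - 2)"
    and "A = four_block_mat (\<alpha> \<cdot>\<^sub>m 1\<^sub>m (n - 2)) C D (\<beta> \<cdot>\<^sub>m 1\<^sub>m 2)"
    and "H = mat_adjoint C * C + D * mat_adjoint D"
    and "Z = D * C"
    and "char_poly H = [:- h1, 1:] * [:- h2, 1:]"
    and "char_poly Z = [:- z1, 1:] * [:- z2, 1:]"
    and "admissible_eigenbasis2 H Z h1 h2 u1 u2"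
    and "z12 = onb_entry Z u1 u2"
    and "z21 = onb_entry Z u2 u1"
  shows "is_hull_of_ellipses_centered_at ((\<alpha> + \<beta>) / 2) (numerical_range A) \<longleftrightarrow>
      (normal_matrix Z \<and> Z * H = H * Z)
    \<or> (z1 = z2 \<and> (\<exists>v k l. eigenvector Z v k \<and> eigenvector H v l))
    \<or> (z1 \<noteq> z2 \<and>
        - ((h1 - h2)\<^sup>2) * (z12 * z21 / (z1 - z2)\<^sup>2) =
          complex_of_real ((cmod z12 + cmod z21)\<^sup>2))"
proof -
  define m where "m = n - 2"
  have m: "0 < m" using assms(1) by (simp add: m_def)
  have C: "C \<in> carrier_mat m 2" and D: "D \<in> carrier_mat 2 m"
    using assms(2,3) by (simp_all add: m_def)
  have A: "A = four_block_mat (\<alpha> \<cdot>\<^sub>m 1\<^sub>m m) C D (\<beta> \<cdot>\<^sub>m 1\<^sub>m 2)" using assms(4) by (simp add: m_def)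
  have Ac: "A \<in> carrier_mat (m + 2) (m + 2)" unfolding A by (rule four_block_carrier_mat) simp_all
  have H: "H \<in> carrier_mat 2 2"
    unfolding assms(5) using mult_carrier_mat[OF mat_adjoint_carrier[OF C] C]
      mult_carrier_mat[OF D mat_adjoint_carrier[OF D]] by simp
  have Z: "Z \<in> carrier_mat 2 2" unfolding assms(6) by (rule mult_carrier_mat[OF D C])
  have on: "orthonormal_basis2 u1 u2" and H1: "H *\<^sub>v u1 = h1 \<cdot>\<^sub>v u1" and H2: "H *\<^sub>v u2 = h2 \<cdot>\<^sub>v u2"
    using assms(9) by (auto simp: admissible_eigenbasis2_def eigenvector_def)
  note ctx = on H Z H1 H2
  note u = basis_simps[OF ctx]
  \<comment> \<open><H v, v> is a sum of two squared norms, so h1 and h2 are real and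
    \<open>d\<close> equals (h1 - h2) / 2 although it is built from real parts.\<close>
  have h_real: "onb_entry H v v = complex_of_real (Re (onb_entry H v v))" if "v \<in> carrier_vec 2" for v
    unfolding onb_entry_def assms(5) quadratic_form_H[OF C D on that] cscalar_prod_self_cvec_norm by simp
  define d where "d = (Re h1 - Re h2) / 2"
  have d: "complex_of_real d = (h1 - h2) / 2"
    using h_real[OF u(1)] h_real[OF u(2)] unfolding onb_entry_eigenbasis[OF ctx]
    by (simp add: d_def)
  define t where "t = (onb_entry Z u1 u1 - onb_entry Z u2 u2) / 2"
  define c0 where "c0 = (cmod ((\<alpha> - \<beta>) / 2))\<^sup>2 / 2 + (Re h1 + Re h2) / 8"
  define c1 where "c1 = ((\<alpha> - \<beta>) / 2)\<^sup>2 / 2 + (onb_entry Z u1 u1 + onb_entry Z u2 u2) / 4"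
  note supp = attains_support_numerical_range_block[OF C D on H1[unfolded assms(5)] H2[unfolded assms(5)] m,
      of _ \<alpha> \<beta>, folded assms(6) A, folded assms(10,11) d_def t_def c0_def c1_def]
  have hull: "is_hull_of_ellipses_centered_at ((\<alpha> + \<beta>) / 2) (numerical_range A) \<longleftrightarrow> discriminant_is_square d t z12 z21"
  proof (rule hull_of_ellipses_iff_discriminant_is_square)
    show "compact (numerical_range A)" by (rule compact_numerical_range[OF Ac])
    show "convex (numerical_range A)" by (rule toeplitz_hausdorff[OF Ac])
    show "attains_support (numerical_range A) w
        (Re (w * ((\<alpha> + \<beta>) / 2)) + sqrt (c0 + Re (w\<^sup>2 * c1) + sqrt (trig_discriminant d t z12 z21 (w\<^sup>2)) / 4))"
      if "cmod w = 1" for w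
      by (rule supp(1)[OF that])
    \<comment> \<open>The nonnegativity is known at squares of unit numbers, and every unit
      \<open>e\<close> is the square of \<open>csqrt e\<close>.\<close>
    show "0 \<le> c0 + Re (e * c1) - sqrt (trig_discriminant d t z12 z21 e) / 4" if "cmod e = 1" for e
      using supp(2)[of "csqrt e"] that by (simp add: norm_csqrt del: times_complex.sel)
  qed
  have D4: "(z1 - z2)\<^sup>2 = 4 * (t\<^sup>2 + z12 * z21)"
    unfolding t_def assms(10,11) by (rule eigenvalue_difference_sq[OF on Z assms(8)])
  have D0: "t\<^sup>2 + z12 * z21 = 0 \<longleftrightarrow> z1 = z2"
    using arg_cong[OF D4, of "\<lambda>x. x = 0"] unfolding mult_eq_0_iff by simp
  have normal: "(normal_matrix Z \<and> Z * H = H * Z) \<longleftrightarrow>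
      cmod z12 = cmod z21 \<and> t * cnj z21 = cnj t * z12 \<and> d * z12 = 0 \<and> d * z21 = 0"
    unfolding normal_matrix_iff_onb_entry[OF ctx] commute_iff_onb_entry[OF ctx] assms(10,11)[symmetric] d
    by (auto simp: t_def)
  have shared: "(\<exists>v k l. eigenvector Z v k \<and> eigenvector H v l) \<longleftrightarrow> d = 0 \<or> z12 = 0 \<or> z21 = 0"
  proof -
    have "eigenvalue Z z1" unfolding eigenvalue_root_char_poly[OF Z] assms(8) by simp
    moreover have "d = 0 \<longleftrightarrow> h1 = h2" using d by (metis divide_eq_0_iff eq_iff_diff_eq_0 of_real_eq_0_iff zero_neq_numeral)
    ultimately show ?thesis
      using shared_eigenvector_iff_onb_entry[OF ctx] unfolding assms(10,11) by simp
  qed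
  \<comment> \<open>The factor 1/4 from d^2 cancels against the one from t^2 + z12 z21 = (z1 - z2)^2
    / 4.\<close>
  have quot: "- ((complex_of_real d)\<^sup>2) * (z12 * z21 / (t\<^sup>2 + z12 * z21)) =
      - ((h1 - h2)\<^sup>2) * (z12 * z21 / (z1 - z2)\<^sup>2)"
    unfolding d D4 by (simp add: power_divide)
  show ?thesis
    unfolding hull discriminant_is_square_iff normal shared D0 quot by (rule refl)
qed

end
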